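(* If $K$ is a field of characteristic $0$, then $a\mapsto\overline a$ (for $a\in\mathcal{TL}$) determines, by $K$-linear extension, a faithful involutive $K$-linear tensor category representation $\mathcal{TL}(K,2)\to\mathcal M(K)$ (given on objects by $n\mapsto2^n$).
   Context: **Temperley–Lieb diagrams.** $\mathbb N=\{0,1,2,\ldots\}$, $[n]=\{1,\ldots,n\}$. For $A\subseteq\mathbb N$, $A'$ and $A''$ are disjoint copies of $A$. $\mathcal{TL}_{m,n}$ is the set of all set partitions $a$ of $[m]\cup[n]'$ in which every block has size $2$ and which are planar: the graph with edges the blocks can be drawn without crossings with vertex $x\in[m]$ at $(x,1)$, $x'\in[n]'$ at $(x,0)$ and all edges inside the strip $0\le y\le1$. The elements of $a$ are called $a$-blocks. For $a\in\mathcal{TL}_{m,n}$, $b\in\mathcal{TL}_{n,t}$, the product graph $\Pi(a,b)$ has vertex set $[m]\cup[n]''\cup[t]'$ and edges those of $a$ (lower vertices $x'$ renamed $x''$) and of $b$ (upper vertices $x$ renamed $x''$); $ab\in\mathcal{TL}_{m,t}$ is the partition in which $x,y\in[m]\cup[t]'$ are in the same block iff they are in the same component of $\Pi(a,b)$; $\Phi(a,b)$ is the number of connected components of $\Pi(a,b)$ contained in $[n]''$. Identities: $\iota_n=\{\{i,i'\}:i\in[n]\}$. Involution $a\mapsto a^*$: swap $i\leftrightarrow i'$. Tensor: for $a\in\mathcal{TL}_{m,n}$, $b\in\mathcal{TL}_{s,t}$, $a\oplus b\in\mathcal{TL}_{m+s,n+t}$ has as blocks all $a$-blocks and $(X+m)\cup(Y+n)'$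 for each $b$-block $X\cup Y'$. **Linear category.** For $\delta\in K$, $\mathcal{TL}(K,\delta)$ has objects $\mathbb N$, hom-sets $\mathcal{TL}_{m,n}(K,\delta)$ the formal $K$-linear combinations of elements of $\mathcal{TL}_{m,n}$, composition $\star$ the $K$-bilinear extension of $a\star b=\delta^{\Phi(a,b)}ab$, and involution and tensor operation the $K$-linear extensions of $^*$ and $\oplus$. Here $\delta=2$. **Matrices.** $\mathcal M(K)$ has object set $\mathbb N$, hom-sets the $m\times n$ matrices over $K$, composition matrix multiplication, involution transpose, tensor operation the Kronecker product $\otimes$ (objects multiply). Matrices of size $2^m\times2^n$ are regarded as having rows/columns indexed by subsets of $[m]$, $[n]$; under this indexing the Kronecker product is $(A\otimes B)_{X\cup(U+m),\,Y\cup(V+n)}=A_{X,Y}B_{U,V}$ for $X\subseteq[m]$, $U\subseteq[s]$, $Y\subseteq[n]$, $V\subseteq[t]$ (for instance, using the bijections $X\mapsto1+\sum_{x\in X}2^{n-x}$ from subsets of $[n]$ to $[2^n]$ this is the usual Kronecker product). For $a\in\mathcal{TL}_{m,n}$, $\overline a$ is the $2^m\times2^n$ matrix with $\overline a_{X,Y}=1$ if $X\cup Y'$ is a (possibly empty) union of $a$-blocks, and $0$ otherwise ($X\subseteq[m]$, $Y\subseteq[n]$). A category representation is a functor; faithful means injective on objects and on morphisms; involutive / tensor means preserving the involutions / tensor operations; $K$-linear means $K$-linear on hom-sets. *)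

theory Defs
  imports
    "HOL-Analysis.Path_Connected"
    "HOL-Library.Disjoint_Sets"
    "HOL-Library.Poly_Mapping"
    "HOL-Library.Nat_Bijection"
    "Jordan_Normal_Form.Matrix"
begin

section \<open>Temperley--Lieb diagrams\<close>

text \<open>\<open>Upper x\<close> is the vertex \<open>x\<close> and \<open>Lower x\<close> is the vertex \<open>x'\<close>.\<close>

datatype vertex = Upper nat | Lower nat

type_synonym diagram = "vertex set set"

definition verts :: "nat \<Rightarrow> nat \<Rightarrow> vertex set" where
  "verts m n = Upper ` {1..m} \<union> Lower ` {1..n}"

fun position :: "vertex \<Rightarrow> real \<times> real" where
  "position (Upper x) = (real x, 1)"
| "position (Lower x) = (real x, 0)"

text \<open>
  Intended for diagrams all of whose blocks have size 2: each block is then an edge. As distinct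
  blocks share no vertex, a drawing without crossings is one whose edges are pairwise disjoint arcs.
\<close>

definition planar :: "diagram \<Rightarrow> bool" where
  "planar a \<longleftrightarrow> (\<exists>\<gamma> :: vertex set \<Rightarrow> real \<Rightarrow> real \<times> real.
     (\<forall>B\<in>a. arc (\<gamma> B)
        \<and> {pathstart (\<gamma> B), pathfinish (\<gamma> B)} = position ` B
        \<and> path_image (\<gamma> B) \<subseteq> UNIV \<times> {0..1})
     \<and> (\<forall>B\<in>a. \<forall>C\<in>a. B \<noteq> C \<longrightarrow> path_image (\<gamma> B) \<inter> path_image (\<gamma> C) = {}))"

definition TL :: "nat \<Rightarrow> nat \<Rightarrow> diagram set" where
  "TL m n = {a. partition_on (verts m n) a \<and> (\<forall>B\<in>a. card B = 2) \<and> planar a}"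

text \<open>Vertices \<open>x\<close>, \<open>x''\<close> and \<open>x'\<close> of a product graph, in this order.\<close>

datatype product_vertex = Top nat | Middle nat | Bottom nat

fun in_first :: "vertex \<Rightarrow> product_vertex" where
  "in_first (Upper x) = Top x"
| "in_first (Lower x) = Middle x"

fun in_second :: "vertex \<Rightarrow> product_vertex" where
  "in_second (Upper x) = Middle x"
| "in_second (Lower x) = Bottom x"

fun in_product :: "vertex \<Rightarrow> product_vertex" where
  "in_product (Upper x) = Top x"
| "in_product (Lower x) = Bottom x"

definition product_verts :: "nat \<Rightarrow> nat \<Rightarrow> nat \<Rightarrow> product_vertex set" where
  "product_verts m n t = Top ` {1..m} \<union> Middle ` {1..n} \<union> Bottom ` {1..t}"

definition product_edges :: "diagram \<Rightarrow> diagram \<Rightarrow> product_vertex set set" where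
  "product_edges a b = (\<lambda>B. in_first ` B) ` a \<union> (\<lambda>B. in_second ` B) ` b"

definition product_connected ::
  "nat \<Rightarrow> nat \<Rightarrow> nat \<Rightarrow> diagram \<Rightarrow> diagram \<Rightarrow> (product_vertex \<times> product_vertex) set" where
  "product_connected m n t a b =
     {(u, v). u \<in> product_verts m n t \<and> v \<in> product_verts m n t
        \<and> (u, v) \<in> {(x, y). {x, y} \<in> product_edges a b}\<^sup>*}"

definition product_components ::
  "nat \<Rightarrow> nat \<Rightarrow> nat \<Rightarrow> diagram \<Rightarrow> diagram \<Rightarrow> product_vertex set set" where
  "product_components m n t a b = product_verts m n t // product_connected m n t a b"

definition diagram_product :: "nat \<Rightarrow> nat \<Rightarrow> nat \<Rightarrow> diagram \<Rightarrow> diagram \<Rightarrow> diagram" where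
  "diagram_product m n t a b =
     verts m t // {(x, y). x \<in> verts m t \<and> y \<in> verts m t
        \<and> (in_product x, in_product y) \<in> product_connected m n t a b}"

definition floating :: "nat \<Rightarrow> nat \<Rightarrow> nat \<Rightarrow> diagram \<Rightarrow> diagram \<Rightarrow> nat" where
  "floating m n t a b = card {C \<in> product_components m n t a b. C \<subseteq> Middle ` {1..n}}"

definition diagram_id :: "nat \<Rightarrow> diagram" where
  "diagram_id n = (\<lambda>i. {Upper i, Lower i}) ` {1..n}"

fun flip_vertex :: "vertex \<Rightarrow> vertex" where
  "flip_vertex (Upper x) = Lower x"
| "flip_vertex (Lower x) = Upper x"

definition diagram_star :: "diagram \<Rightarrow> diagram" where
  "diagram_star a = (\<lambda>B. flip_vertex ` B) ` a"

fun shift_vertex :: "nat \<Rightarrow> nat \<Rightarrow> vertex \<Rightarrow> vertex" where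
  "shift_vertex m n (Upper x) = Upper (x + m)"
| "shift_vertex m n (Lower x) = Lower (x + n)"

text \<open>Here \<open>m\<close>, \<open>n\<close> are the numbers of upper and lower vertices of \<open>a\<close>.\<close>

definition diagram_tensor :: "nat \<Rightarrow> nat \<Rightarrow> diagram \<Rightarrow> diagram \<Rightarrow> diagram" where
  "diagram_tensor m n a b = a \<union> (\<lambda>B. shift_vertex m n ` B) ` b"


section \<open>Linear categories with involution and tensor operation\<close>

text \<open>
  Every element of the type \<open>'o\<close> is an object. Morphisms do not carry their source and target,
  so the operations and the morphism part of a functor take these as additional arguments.
  Composition is written in diagrammatic order: \<open>Comp C l m n f g\<close> is the composite of
  \<open>f \<in> Hom C l m\<close> and \<open>g \<in> Hom C m n\<close>; \<open>TenM C m n s t f g\<close> is the tensor product of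
  \<open>f \<in> Hom C m n\<close> and \<open>g \<in> Hom C s t\<close>.
\<close>

record ('o, 'm, 'k) linear_cat =
  Hom   :: "'o \<Rightarrow> 'o \<Rightarrow> 'm set"
  Ident :: "'o \<Rightarrow> 'm"
  Comp  :: "'o \<Rightarrow> 'o \<Rightarrow> 'o \<Rightarrow> 'm \<Rightarrow> 'm \<Rightarrow> 'm"
  Add   :: "'m \<Rightarrow> 'm \<Rightarrow> 'm"
  Scale :: "'k \<Rightarrow> 'm \<Rightarrow> 'm"
  Star  :: "'m \<Rightarrow> 'm"
  TenO  :: "'o \<Rightarrow> 'o \<Rightarrow> 'o"
  TenM  :: "'o \<Rightarrow> 'o \<Rightarrow> 'o \<Rightarrow> 'o \<Rightarrow> 'm \<Rightarrow> 'm \<Rightarrow> 'm"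

definition is_category :: "('o, 'm, 'k) linear_cat \<Rightarrow> bool" where
  "is_category C \<longleftrightarrow>
     (\<forall>n. Ident C n \<in> Hom C n n)
   \<and> (\<forall>l m n. \<forall>f\<in>Hom C l m. \<forall>g\<in>Hom C m n. Comp C l m n f g \<in> Hom C l n)
   \<and> (\<forall>m n. \<forall>f\<in>Hom C m n. Comp C m m n (Ident C m) f = f \<and> Comp C m n n f (Ident C n) = f)
   \<and> (\<forall>k l m n. \<forall>f\<in>Hom C k l. \<forall>g\<in>Hom C l m. \<forall>h\<in>Hom C m n.
        Comp C k m n (Comp C k l m f g) h = Comp C k l n f (Comp C l m n g h))"

definition is_functor ::
  "('o, 'm, 'k) linear_cat \<Rightarrow> ('p, 'n, 'k) linear_cat \<Rightarrow> ('o \<Rightarrow> 'p) \<Rightarrow> ('o \<Rightarrow> 'o \<Rightarrow> 'm \<Rightarrow> 'n) \<Rightarrow> bool" where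
  "is_functor C D Fo Fm \<longleftrightarrow> is_category C \<and> is_category D
   \<and> (\<forall>m n. \<forall>f\<in>Hom C m n. Fm m n f \<in> Hom D (Fo m) (Fo n))
   \<and> (\<forall>n. Fm n n (Ident C n) = Ident D (Fo n))
   \<and> (\<forall>l m n. \<forall>f\<in>Hom C l m. \<forall>g\<in>Hom C m n.
        Fm l n (Comp C l m n f g) = Comp D (Fo l) (Fo m) (Fo n) (Fm l m f) (Fm m n g))"

definition faithful_rep ::
  "('o, 'm, 'k) linear_cat \<Rightarrow> ('o \<Rightarrow> 'p) \<Rightarrow> ('o \<Rightarrow> 'o \<Rightarrow> 'm \<Rightarrow> 'n) \<Rightarrow> bool" where
  "faithful_rep C Fo Fm \<longleftrightarrow> inj Fo
   \<and> inj_on (\<lambda>(m, n, f). (Fo m, Fo n, Fm m n f)) {(m, n, f). f \<in> Hom C m n}"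

definition linear_rep ::
  "('o, 'm, 'k) linear_cat \<Rightarrow> ('p, 'n, 'k) linear_cat \<Rightarrow> ('o \<Rightarrow> 'o \<Rightarrow> 'm \<Rightarrow> 'n) \<Rightarrow> bool" where
  "linear_rep C D Fm \<longleftrightarrow>
     (\<forall>m n. \<forall>f\<in>Hom C m n. \<forall>g\<in>Hom C m n. Fm m n (Add C f g) = Add D (Fm m n f) (Fm m n g))
   \<and> (\<forall>m n c. \<forall>f\<in>Hom C m n. Fm m n (Scale C c f) = Scale D c (Fm m n f))"

definition involutive_rep ::
  "('o, 'm, 'k) linear_cat \<Rightarrow> ('p, 'n, 'k) linear_cat \<Rightarrow> ('o \<Rightarrow> 'o \<Rightarrow> 'm \<Rightarrow> 'n) \<Rightarrow> bool" where
  "involutive_rep C D Fm \<longleftrightarrow>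
     (\<forall>m n. \<forall>f\<in>Hom C m n. Fm n m (Star C f) = Star D (Fm m n f))"

definition tensor_rep ::
  "('o, 'm, 'k) linear_cat \<Rightarrow> ('p, 'n, 'k) linear_cat \<Rightarrow> ('o \<Rightarrow> 'p) \<Rightarrow> ('o \<Rightarrow> 'o \<Rightarrow> 'm \<Rightarrow> 'n) \<Rightarrow> bool" where
  "tensor_rep C D Fo Fm \<longleftrightarrow>
     (\<forall>m s. Fo (TenO C m s) = TenO D (Fo m) (Fo s))
   \<and> (\<forall>m n s t. \<forall>f\<in>Hom C m n. \<forall>g\<in>Hom C s t.
        Fm (TenO C m s) (TenO C n t) (TenM C m n s t f g)
          = TenM D (Fo m) (Fo n) (Fo s) (Fo t) (Fm m n f) (Fm s t g))"


section \<open>The linear Temperley--Lieb category\<close>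

type_synonym 'k combination = "diagram \<Rightarrow>\<^sub>0 'k"

definition TL_comp :: "'k::field \<Rightarrow> nat \<Rightarrow> nat \<Rightarrow> nat
    \<Rightarrow> 'k combination \<Rightarrow> 'k combination \<Rightarrow> 'k combination" where
  "TL_comp \<delta> m n t f g =
     (\<Sum>a\<in>Poly_Mapping.keys f. \<Sum>b\<in>Poly_Mapping.keys g. Poly_Mapping.single (diagram_product m n t a b)
        (Poly_Mapping.lookup f a * Poly_Mapping.lookup g b * \<delta> ^ floating m n t a b))"

definition TL_star :: "'k::field combination \<Rightarrow> 'k combination" where
  "TL_star f = (\<Sum>a\<in>Poly_Mapping.keys f. Poly_Mapping.single (diagram_star a) (Poly_Mapping.lookup f a))"

definition TL_tensor ::
  "nat \<Rightarrow> nat \<Rightarrow> 'k::field combination \<Rightarrow> 'k combination \<Rightarrow> 'k combination" where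
  "TL_tensor m n f g =
     (\<Sum>a\<in>Poly_Mapping.keys f. \<Sum>b\<in>Poly_Mapping.keys g.
        Poly_Mapping.single (diagram_tensor m n a b) (Poly_Mapping.lookup f a * Poly_Mapping.lookup g b))"

definition TL_cat :: "'k::field \<Rightarrow> (nat, 'k combination, 'k) linear_cat" where
  "TL_cat \<delta> = \<lparr>
     Hom = \<lambda>m n. {f. Poly_Mapping.keys f \<subseteq> TL m n},
     Ident = \<lambda>n. Poly_Mapping.single (diagram_id n) 1,
     Comp = TL_comp \<delta>,
     Add = (+),
     Scale = \<lambda>c. Poly_Mapping.map ((*) c),
     Star = TL_star,
     TenO = (+),
     TenM = \<lambda>m n s t. TL_tensor m n \<rparr>"


section \<open>The matrix category\<close>

definition kronecker :: "'k::semiring_0 mat \<Rightarrow> 'k mat \<Rightarrow> 'k mat" where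
  "kronecker A B = Matrix.mat (dim_row A * dim_row B) (dim_col A * dim_col B)
     (\<lambda>(i, j). A $$ (i div dim_row B, j div dim_col B) * B $$ (i mod dim_row B, j mod dim_col B))"

definition mat_cat :: "(nat, 'k::field mat, 'k) linear_cat" where
  "mat_cat = \<lparr>
     Hom = \<lambda>m n. carrier_mat m n,
     Ident = 1\<^sub>m,
     Comp = \<lambda>l m n. (*),
     Add = (+),
     Scale = smult_mat,
     Star = transpose_mat,
     TenO = (*),
     TenM = \<lambda>m n s t. kronecker \<rparr>"


section \<open>The matrix of a diagram\<close>

text \<open>
  The 0-based position of \<open>X \<subseteq> [n]\<close>: the matrix library numbers rows and columns from 0. With
  this choice of bijection the Kronecker product takes the index pair \<open>(X, U)\<close>, with \<open>X \<subseteq> [m]\<close>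
  and \<open>U \<subseteq> [s]\<close>, to the index of \<open>X \<union> (U + m) \<subseteq> [m + s]\<close>.
\<close>

definition subset_index :: "nat \<Rightarrow> nat set \<Rightarrow> nat" where
  "subset_index n X = (\<Sum>x\<in>X. 2 ^ (n - x))"

definition subset_at :: "nat \<Rightarrow> nat \<Rightarrow> nat set" where
  "subset_at n = the_inv_into (Pow {1..n}) (subset_index n)"

lemma bij_betw_subset_index: "bij_betw (subset_index n) (Pow {1..n}) {..<2 ^ n}"
proof -
  have inj_minus: "inj_on (\<lambda>x. n - x) X" if "X \<subseteq> {1..n}" for X
    using that by (intro inj_onI) (auto simp: subset_iff, metis diff_diff_cancel)
  have encode: "subset_index n X = set_encode ((\<lambda>x. n - x) ` X)" if "X \<subseteq> {1..n}" for X
    using inj_minus[OF that] by (simp add: subset_index_def set_encode_def sum.reindex o_def)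
  have inj: "inj_on (subset_index n) (Pow {1..n})"
  proof (rule inj_onI)
    fix X Y assume XY: "X \<in> Pow {1..n}" "Y \<in> Pow {1..n}" "subset_index n X = subset_index n Y"
    hence "finite X" "finite Y" by (auto intro: finite_subset)
    hence "(\<lambda>x. n - x) ` X = (\<lambda>x. n - x) ` Y"
      using XY encode by (auto simp: set_encode_eq)
    thus "X = Y" using inj_on_image_eq_iff[OF inj_minus[OF order_refl]] XY by blast
  qed
  have "subset_index n X < 2 ^ n" if "X \<subseteq> {1..n}" for X
  proof -
    have "subset_index n X = (\<Sum>i\<in>(\<lambda>x. n - x) ` X. 2 ^ i)"
      using inj_minus[OF that] by (simp add: subset_index_def sum.reindex o_def)
    also have "\<dots> \<le> (\<Sum>i<n. 2 ^ i)"
      using that by (intro sum_mono2) (auto simp: subset_iff)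
    also have "\<dots> < 2 ^ n" by (induction n) auto
    finally show ?thesis .
  qed
  hence "subset_index n ` Pow {1..n} = {..<2 ^ n}"
    using inj by (intro card_subset_eq) (auto simp: card_image card_Pow)
  with inj show ?thesis by (simp add: bij_betw_def)
qed

definition diagram_matrix :: "nat \<Rightarrow> nat \<Rightarrow> diagram \<Rightarrow> 'k::field mat" where
  "diagram_matrix m n a = Matrix.mat (2 ^ m) (2 ^ n)
     (\<lambda>(i, j). if \<exists>S\<subseteq>a. \<Union>S = Upper ` subset_at m i \<union> Lower ` subset_at n j then 1 else 0)"

text \<open>
  The \<open>K\<close>-linear extension, written entrywise because the type of matrices of all sizes is not
  an additive monoid.
\<close>

definition TL_rep :: "nat \<Rightarrow> nat \<Rightarrow> 'k::field combination \<Rightarrow> 'k mat" where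
  "TL_rep m n f = Matrix.mat (2 ^ m) (2 ^ n)
     (\<lambda>ij. \<Sum>a\<in>Poly_Mapping.keys f. Poly_Mapping.lookup f a * diagram_matrix m n a $$ ij)"

end

theory Submission
  imports Defs "HOL-Analysis.Fashoda_Theorem" "HOL-Analysis.Arcwise_Connected"
begin

text \<open>
  Three facts carry the theorem.

  \<^emph>\<open>Products of diagrams\<close> (\<open>diagram_product_in_TL\<close>). The edges of a product graph
  form two matchings, each vertex that one of them misses being an outer vertex. A component of a
  union of two matchings is a path or a cycle, so it has two such vertices or none, and the product
  is again a pairing. It is planar because the two drawings, stacked above each other and joined by
  vertical segments, give disjoint connected sets, one for each component, and a path inside such a
  set contains an arc.

  \<^emph>\<open>Multiplicativity\<close> (\<open>diagram_matrix_mult\<close>). The entry of a matrix product at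
  \<open>(X, Z)\<close> counts the sets \<open>Y\<close> of middle vertices for which \<open>X \<union> Y'' \<union> Z'\<close> is a union of
  components of the product graph. Whether there is such a \<open>Y\<close> depends on the components with outer
  vertices; if there is one, each floating component may be put into \<open>Y\<close> or left out, which is
  where \<open>\<delta> = 2\<close> comes from.

  \<^emph>\<open>Linear independence\<close> (\<open>block_union_indicators_independent\<close>). Read the boundary of the
  strip as a line, first the upper vertices from right to left, then the lower ones from left to
  right. By a form of the Jordan curve theorem, the blocks of a planar diagram do not interlace on
  this line, so the vertices strictly between the two ends of a block are paired among themselves
  and the ends have positions of opposite parity. Complementing a vertex set \<open>T\<close> at every second
  position therefore turns the condition that \<open>T\<close> contains exactly one end of each block into the
  condition of being a union of blocks. Now let \<open>T\<close> be the set of left ends of the blocks of a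
  diagram \<open>a\<close>. If \<open>T\<close> contains exactly one end of every block of \<open>b\<close>, then the left ends of \<open>b\<close> have a smaller sum of
  positions than \<open>T\<close> unless they coincide with \<open>T\<close>, and then \<open>b = a\<close>. So in a vanishing linear
  combination of the matrices, the entry that belongs to a diagram with the least sum of left ends
  isolates the coefficient of that diagram.

  Multiplicativity and linear independence together also give the axioms of a category for the
  source: the unit laws and associativity hold after applying an injective map to matrices that
  respects compositions and identities. Involution and tensor product are compared entry by entry.
\<close>

section \<open>Pairings and the components of a product graph\<close>

definition pairing :: "nat \<Rightarrow> nat \<Rightarrow> diagram \<Rightarrow> bool" where
  "pairing m n a \<longleftrightarrow> partition_on (verts m n) a \<and> (\<forall>B\<in>a. card B = 2)"

lemma TL_iff: "a \<in> TL m n \<longleftrightarrow> pairing m n a \<and> planar a"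
  by (simp add: TL_def pairing_def)

lemma pairingD:
  assumes "pairing m n a"
  shows "\<Union>a = verts m n" "disjoint a" "\<And>B. B \<in> a \<Longrightarrow> card B = 2"
  using assms by (auto simp: pairing_def partition_on_def)

lemma pairing_block_eq:
  "pairing m n a \<Longrightarrow> B \<in> a \<Longrightarrow> C \<in> a \<Longrightarrow> x \<in> B \<Longrightarrow> x \<in> C \<Longrightarrow> B = C"
  using pairingD(2)[of m n a] by (auto simp: disjoint_def)

lemma finite_verts [simp]: "finite (verts m n)"
  by (simp add: verts_def)

lemma verts_mem [simp]:
  "Upper x \<in> verts m n \<longleftrightarrow> x \<in> {1..m}" "Lower x \<in> verts m n \<longleftrightarrow> x \<in> {1..n}"
  by (auto simp: verts_def)

lemma finite_product_verts [simp]: "finite (product_verts m n t)"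
  by (simp add: product_verts_def)

lemma card_Union_pairs:
  assumes "disjoint P" "\<And>B. B \<in> P \<Longrightarrow> card B = 2"
  shows "card (\<Union>P) = 2 * card P"
proof -
  have "card (\<Union>P) = sum card P"
    using assms by (intro card_Union_disjoint) (auto simp: disjoint_def pairwise_def disjnt_def intro: card_ge_0_finite)
  also have "\<dots> = 2 * card P" using assms(2) by simp
  finally show ?thesis .
qed

text \<open>
  The vertices of \<open>D\<close> that \<open>P\<close> does not match inside \<open>D\<close>: their partner lies outside \<open>D\<close>, or they
  have none.
\<close>

definition loose :: "'a set set \<Rightarrow> 'a set \<Rightarrow> 'a set" where
  "loose P D = {x \<in> D. \<not> (\<exists>B\<in>P. x \<in> B \<and> B \<subseteq> D)}"

lemma card_loose_insert_partner:
  assumes "disjoint P" "{u, v} \<in> P" "u \<in> D" "v \<notin> D" "finite D"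
  shows "card (loose P (insert v D)) + 1 \<le> card (loose P D)"
proof -
  have u: "u \<in> loose P D"
  proof (rule ccontr)
    assume "u \<notin> loose P D"
    then obtain B where "B \<in> P" "u \<in> B" "B \<subseteq> D" using assms(3) by (auto simp: loose_def)
    moreover from this have "B = {u, v}" using disjointD[OF assms(1) _ assms(2), of B] by blast
    ultimately show False using assms(4) by blast
  qed
  have "loose P (insert v D) \<subseteq> loose P D - {u}"
  proof
    fix x assume x: "x \<in> loose P (insert v D)"
    hence no: "\<not> (x \<in> B \<and> B \<subseteq> insert v D)" if "B \<in> P" for B using that by (simp add: loose_def)
    have neq: "x \<noteq> u" "x \<noteq> v" using no[OF assms(2)] assms(3) by auto
    moreover have "x \<in> D" using x neq(2) by (simp add: loose_def)
    moreover have "\<not> (x \<in> B \<and> B \<subseteq> D)" if "B \<in> P" for B using no[OF that] by blast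
    ultimately show "x \<in> loose P D - {u}" by (simp add: loose_def)
  qed
  hence "card (loose P (insert v D)) \<le> card (loose P D - {u})"
    using assms(5) by (intro card_mono) (auto simp: loose_def)
  moreover have "card (loose P D - {u}) + 1 = card (loose P D)"
    using u assms(5) card_Suc_Diff1[of "loose P D" u] by (simp add: loose_def)
  ultimately show ?thesis by simp
qed

lemma card_loose_insert:
  assumes "finite D"
  shows "card (loose P (insert v D)) \<le> card (loose P D) + 1"
proof -
  have "card (loose P (insert v D)) \<le> card (insert v (loose P D))"
    using assms by (intro card_mono) (auto simp: loose_def)
  also have "\<dots> \<le> card (loose P D) + 1" using assms by (simp add: loose_def card_insert_if)
  finally show ?thesis .
qed

text \<open>
  Explore the component from \<open>r\<close>, one vertex at a time. A new vertex is reached along an edge of one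
  matching, which loses a loose vertex, and it adds at most one loose vertex for the other. So the
  number of loose vertices, which is at most 2 at the start, stays at most 2. In the full component
  the loose vertices are the unmatched ones, and their number is even because the matched vertices of
  the component come in pairs for each of the two matchings.
\<close>

lemma component_of_two_matchings:
  assumes P: "disjoint P" "\<And>B. B \<in> P \<Longrightarrow> card B = 2"
    and Q: "disjoint Q" "\<And>B. B \<in> Q \<Longrightarrow> card B = 2"
    and C: "C = {(x, y). {x, y} \<in> P \<union> Q}\<^sup>* `` {r}" and fin: "finite C"
  shows "card (C - \<Union>P) + card (C - \<Union>Q) \<in> {0, 2}"
proof -
  have closed: "B \<subseteq> C" if "B \<in> P \<union> Q" "x \<in> B" "x \<in> C" for B x
  proof
    fix y assume "y \<in> B"
    show "y \<in> C"
    proof (cases "y = x")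
      case False
      have "card B = 2" using P Q that(1) by blast
      hence "B = {x, y}" using that(2) \<open>y \<in> B\<close> False by (auto simp: card_2_iff)
      thus ?thesis using that(1,3) unfolding C by (auto intro: rtrancl_into_rtrancl)
    qed (use that in simp)
  qed
  have even: "even (card (C \<inter> \<Union>S))" if "S \<subseteq> P \<union> Q" "disjoint S" for S
  proof -
    have "C \<inter> \<Union>S = \<Union>{B \<in> S. B \<subseteq> C}" using closed that(1) by blast
    moreover have "card (\<Union>{B \<in> S. B \<subseteq> C}) = 2 * card {B \<in> S. B \<subseteq> C}"
      using that P Q by (intro card_Union_pairs) (auto simp: disjoint_def)
    ultimately show ?thesis by simp
  qed
  \<comment> \<open>The invariant of the exploration; a maximal set with this property is the whole component.\<close>
  define good where "good D \<longleftrightarrow> D \<subseteq> C \<and> r \<in> D \<and> card (loose P D) + card (loose Q D) \<le> 2" for D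
  have "loose S {r} \<subseteq> {r}" for S by (auto simp: loose_def)
  hence "card (loose S {r}) \<le> 1" for S by (metis card_mono finite.emptyI finite_insert is_singletonI is_singleton_altdef)
  from add_mono[OF this[of P] this[of Q]] have "good {r}" by (auto simp: good_def C)
  moreover have "finite {D. good D}"
    using fin by (auto simp: good_def intro: finite_subset[of _ "Pow C"])
  ultimately obtain D where D: "good D" and max: "\<And>D'. good D' \<Longrightarrow> D \<subseteq> D' \<Longrightarrow> D = D'"
    using finite_has_maximal[of "{D. good D}"] by blast
  have finD: "finite D" using D fin by (auto simp: good_def intro: finite_subset)
  have "y \<in> D" if "(x, y) \<in> {(x, y). {x, y} \<in> P \<union> Q}" "x \<in> D" for x y
  proof (rule ccontr)
    assume y: "y \<notin> D"
    have e: "{x, y} \<in> P \<union> Q" using that(1) by simp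
    have "y \<in> C" using closed[OF e, of x] that(2) D by (auto simp: good_def)
    moreover have "card (loose P (insert y D)) + card (loose Q (insert y D)) \<le> card (loose P D) + card (loose Q D)"
      using e card_loose_insert_partner[OF P(1) _ that(2) y finD] card_loose_insert_partner[OF Q(1) _ that(2) y finD]
        card_loose_insert[OF finD, of P y] card_loose_insert[OF finD, of Q y] by fastforce
    ultimately have "good (insert y D)" using D unfolding good_def by auto
    thus False using max y by blast
  qed
  hence "{(x, y). {x, y} \<in> P \<union> Q}\<^sup>* `` D = D" by (intro Image_closed_trancl) blast
  moreover have "C \<subseteq> {(x, y). {x, y} \<in> P \<union> Q}\<^sup>* `` D"
    unfolding C using D by (intro Image_mono) (auto simp: good_def)
  ultimately have "C \<subseteq> D" by (simp only:)
  hence "D = C" using D by (auto simp: good_def)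
  moreover have "loose P C = C - \<Union>P" "loose Q C = C - \<Union>Q"
    using closed by (auto simp: loose_def)
  ultimately have le: "card (C - \<Union>P) + card (C - \<Union>Q) \<le> 2" using D by (simp add: good_def)
  have "card C = card (C \<inter> \<Union>P) + card (C - \<Union>P)" "card C = card (C \<inter> \<Union>Q) + card (C - \<Union>Q)"
    using fin by (metis card_Int_Diff)+
  hence "even (card (C - \<Union>P) + card (C - \<Union>Q))"
    using even[of P] even[of Q] P Q by (metis Un_upper1 Un_upper2 even_add)
  then obtain k where "card (C - \<Union>P) + card (C - \<Union>Q) = 2 * k" by (elim evenE)
  with le show ?thesis by auto
qed

abbreviation product_adjacent :: "diagram \<Rightarrow> diagram \<Rightarrow> (product_vertex \<times> product_vertex) set" where
  "product_adjacent a b \<equiv> {(x, y). {x, y} \<in> product_edges a b}"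

lemma product_connected_equiv: "equiv (product_verts m n t) (product_connected m n t a b)"
proof (rule equivI)
  have "sym (product_adjacent a b)" by (auto intro: symI simp: insert_commute)
  hence "sym ((product_adjacent a b)\<^sup>*)" by (rule sym_rtrancl)
  thus "sym (product_connected m n t a b)" by (auto simp: product_connected_def sym_def)
  show "trans (product_connected m n t a b)"
    by (auto simp: product_connected_def trans_def)
qed (auto simp: product_connected_def refl_on_def)

lemma in_product_mem [simp]: "in_product x \<in> product_verts m n t \<longleftrightarrow> x \<in> verts m t"
  by (cases x) (auto simp: product_verts_def verts_def)

lemma inj_in [simp]: "inj in_first" "inj in_second" "inj in_product"
  by (rule injI, case_tac x; case_tac y; simp)+

definition outer_connected :: "nat \<Rightarrow> nat \<Rightarrow> nat \<Rightarrow> diagram \<Rightarrow> diagram \<Rightarrow> (vertex \<times> vertex) set" where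
  "outer_connected m n t a b = {(x, y). x \<in> verts m t \<and> y \<in> verts m t
     \<and> (in_product x, in_product y) \<in> product_connected m n t a b}"

lemma diagram_product_eq: "diagram_product m n t a b = verts m t // outer_connected m n t a b"
  by (simp add: diagram_product_def outer_connected_def)

lemma equiv_imp_sym: "equiv A r \<Longrightarrow> sym r" and equiv_imp_trans: "equiv A r \<Longrightarrow> trans r"
  and equiv_imp_refl: "equiv A r \<Longrightarrow> refl_on A r"
  by (simp_all add: equiv_def)

lemma outer_connected_equiv: "equiv (verts m t) (outer_connected m n t a b)"
proof (rule equivI)
  note R = product_connected_equiv[of m n t a b]
  show "sym (outer_connected m n t a b)"
    using symD[OF equiv_imp_sym[OF R]] by (auto simp: outer_connected_def intro!: symI)
  show "trans (outer_connected m n t a b)"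
    using transD[OF equiv_imp_trans[OF R]] by (auto simp: outer_connected_def intro!: transI)
  show "refl_on (verts m t) (outer_connected m n t a b)"
    using equiv_imp_refl[OF R] by (auto simp: outer_connected_def refl_on_def)
qed (auto simp: outer_connected_def)

lemma edges_verts:
  assumes "\<Union>a = verts m n" "\<Union>b = verts n t"
  shows "\<Union>((\<lambda>B. in_first ` B) ` a) = Top ` {1..m} \<union> Middle ` {1..n}"
    "\<Union>((\<lambda>B. in_second ` B) ` b) = Middle ` {1..n} \<union> Bottom ` {1..t}"
    "\<Union>(product_edges a b) = product_verts m n t"
proof -
  have "\<Union>((\<lambda>B. in_first ` B) ` a) = in_first ` verts m n"
    by (simp add: image_Union flip: assms(1))
  thus 1: "\<Union>((\<lambda>B. in_first ` B) ` a) = Top ` {1..m} \<union> Middle ` {1..n}"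
    by (simp add: verts_def image_Un image_image)
  have "\<Union>((\<lambda>B. in_second ` B) ` b) = in_second ` verts n t"
    by (simp add: image_Union flip: assms(2))
  thus 2: "\<Union>((\<lambda>B. in_second ` B) ` b) = Middle ` {1..n} \<union> Bottom ` {1..t}"
    by (simp add: verts_def image_Un image_image)
  show "\<Union>(product_edges a b) = product_verts m n t"
    unfolding product_edges_def Union_Un_distrib 1 2 by (auto simp: product_verts_def)
qed

lemma product_connected_class:
  assumes "\<Union>a = verts m n" "\<Union>b = verts n t" "u \<in> product_verts m n t"
  shows "product_connected m n t a b `` {u} = (product_adjacent a b)\<^sup>* `` {u}"
proof -
  have "v \<in> product_verts m n t" if "(u, v) \<in> (product_adjacent a b)\<^sup>*" for v
    using that by induction (use assms edges_verts[OF assms(1,2)] in auto)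
  thus ?thesis using assms(3) by (auto simp: product_connected_def)
qed

text \<open>
  The unmatched vertices of the two matchings are the lower and the upper outer vertices,
  so \<open>component_of_two_matchings\<close> says that each component with an outer vertex has exactly two.
\<close>

lemma pairing_diagram_product:
  assumes a: "pairing m n a" and b: "pairing n t b"
  shows "pairing m t (diagram_product m n t a b)"
  unfolding pairing_def
proof (intro conjI ballI)
  show part: "partition_on (verts m t) (diagram_product m n t a b)"
    unfolding diagram_product_eq by (rule partition_on_quotient[OF outer_connected_equiv])
  fix B assume B: "B \<in> diagram_product m n t a b"
  then obtain x where x: "x \<in> verts m t" "B = outer_connected m n t a b `` {x}"
    unfolding diagram_product_eq by (auto elim: quotientE)
  let ?P = "(\<lambda>B. in_first ` B) ` a" and ?Q = "(\<lambda>B. in_second ` B) ` b"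
  let ?C = "product_connected m n t a b `` {in_product x}"
  note U = edges_verts[OF pairingD(1)[OF a] pairingD(1)[OF b]]
  have "card (?C - \<Union>?P) + card (?C - \<Union>?Q) \<in> {0, 2}"
  proof (rule component_of_two_matchings)
    show "disjoint ?P" "disjoint ?Q"
      using pairingD(2)[OF a] pairingD(2)[OF b] 
      by (auto simp: disjoint_def inj_image_eq_iff simp flip: image_Int)
    show "card B = 2" if "B \<in> ?P" for B
      using that pairingD(3)[OF a] by (auto simp: card_image inj_on_subset[OF inj_in(1)])
    show "card B = 2" if "B \<in> ?Q" for B
      using that pairingD(3)[OF b] by (auto simp: card_image inj_on_subset[OF inj_in(2)])
    show "?C = {(x, y). {x, y} \<in> ?P \<union> ?Q}\<^sup>* `` {in_product x}"
      using product_connected_class[OF pairingD(1)[OF a] pairingD(1)[OF b]] x(1)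
      by (simp add: product_edges_def)
    show "finite ?C"
      by (rule finite_subset[OF _ finite_product_verts[of m n t]]) (auto simp: product_connected_def)
  qed
  moreover have "card (?C - \<Union>?P) + card (?C - \<Union>?Q) = card B"
  proof -
    have C: "?C \<subseteq> product_verts m n t" by (auto simp: product_connected_def)
    have "in_product ` B = (?C - \<Union>?P) \<union> (?C - \<Union>?Q)"
    proof -
      have "in_product ` B = ?C \<inter> in_product ` verts m t"
        using x by (auto simp: outer_connected_def)
      also have "in_product ` verts m t = Top ` {1..m} \<union> Bottom ` {1..t}"
        by (simp add: verts_def image_Un image_image)
      also have "?C \<inter> \<dots> = (?C - \<Union>?P) \<union> (?C - \<Union>?Q)"
        using C unfolding U(1,2) by (auto simp: product_verts_def)
      finally show ?thesis .
    qed
    moreover have "(?C - \<Union>?P) \<inter> (?C - \<Union>?Q) = {}"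
      using C unfolding U(1,2) by (auto simp: product_verts_def)
    moreover have "finite ?C" using C by (rule finite_subset) simp
    ultimately have "card (in_product ` B) = card (?C - \<Union>?P) + card (?C - \<Union>?Q)"
      by (simp add: card_Un_disjoint)
    thus ?thesis by (simp add: card_image inj_on_subset[OF inj_in(3)])
  qed
  moreover have "finite B" "B \<noteq> {}"
    using part B unfolding partition_on_def
    by (metis Union_upper finite_subset finite_verts) (use part B in \<open>auto simp: partition_on_def\<close>)
  ultimately show "card B = 2" by auto
qed

section \<open>Planar diagrams do not interlace\<close>

(* From here on the dollar sign denotes the coordinates of a point of the plane. *)
no_notation Matrix.vec_index (infixl "$" 100)

text \<open>
  The position of a vertex on the boundary of the strip, cut open at its left end and read as a
  line. The lower vertices are shifted by one so that the positions occurring in \<open>verts m n\<close> are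
  consecutive integers, as the parity argument requires.
\<close>

fun boundary_pos :: "vertex \<Rightarrow> int" where
  "boundary_pos (Upper x) = - int x"
| "boundary_pos (Lower x) = int x - 1"

definition noncrossing :: "diagram \<Rightarrow> bool" where
  "noncrossing a \<longleftrightarrow> (\<forall>p q r s. {p, q} \<in> a \<longrightarrow> {r, s} \<in> a \<longrightarrow>
     \<not> (boundary_pos p < boundary_pos r \<and> boundary_pos r < boundary_pos q \<and> boundary_pos q < boundary_pos s))"

text \<open>
  In complex notation this is \<open>x + i y \<mapsto> exp (x + i \<pi> y)\<close>. It carries the strip into the upper half
  plane and unrolls its boundary into the real axis, in the order given by \<open>boundary_pos\<close>. Thus
  the upper and lower vertices of a diagram need not be treated separately.
\<close>

definition bend :: "real \<times> real \<Rightarrow> real ^ 2" where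
  "bend = (\<lambda>(x, y). vector [exp x * cos (pi * y), exp x * sin (pi * y)])"

lemma bend_component [simp]:
  "bend z $ 1 = exp (fst z) * cos (pi * snd z)" "bend z $ 2 = exp (fst z) * sin (pi * snd z)"
  by (simp_all add: bend_def case_prod_unfold)

lemma continuous_on_bend: "continuous_on S bend"
proof -
  have bend: "bend = (\<lambda>z. \<chi> i. if i = 1 then exp (fst z) * cos (pi * snd z) else exp (fst z) * sin (pi * snd z))"
    by (intro ext) (simp add: Finite_Cartesian_Product.vec_eq_iff forall_2)
  have "continuous_on S (\<lambda>z :: real \<times> real.
      if i = 1 then exp (fst z) * cos (pi * snd z) else exp (fst z) * sin (pi * snd z))" for i :: 2
    by (cases "i = 1") (auto intro!: continuous_intros)
  thus ?thesis unfolding bend by (rule continuous_on_vec_lambda)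
qed


lemma inj_on_bend: "inj_on bend (UNIV \<times> {0..1})"
proof (rule inj_onI)
  fix z w :: "real \<times> real"
  assume z: "z \<in> UNIV \<times> {0..1}" and w: "w \<in> UNIV \<times> {0..1}" and eq: "bend z = bend w"
  have c: "exp (fst z) * cos (pi * snd z) = exp (fst w) * cos (pi * snd w)"
    and s: "exp (fst z) * sin (pi * snd z) = exp (fst w) * sin (pi * snd w)"
    using arg_cong[OF eq, of "\<lambda>v. v $ 1"] arg_cong[OF eq, of "\<lambda>v. v $ 2"] by simp_all
  have norm: "(r * cos t)\<^sup>2 + (r * sin t)\<^sup>2 = r\<^sup>2" for r t :: real
    by (simp add: power_mult_distrib flip: distrib_left)
  have "(exp (fst z))\<^sup>2 = (exp (fst w))\<^sup>2"
    using norm[of "exp (fst z)" "pi * snd z"] norm[of "exp (fst w)" "pi * snd w"] c s by simp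
  hence "exp (fst z) = exp (fst w)" by (rule power2_eq_imp_eq) auto
  hence fst: "fst z = fst w" by simp
  hence "cos (pi * snd z) = cos (pi * snd w)" using c by simp
  moreover have "0 \<le> pi * snd z" "pi * snd z \<le> pi" "0 \<le> pi * snd w" "pi * snd w \<le> pi"
    using z w by (auto simp: mult_left_le)
  ultimately have "pi * snd z = pi * snd w" using cos_inj_pi by blast
  with fst show "z = w" by (simp add: prod_eq_iff)
qed

lemma bend_position:
  "bend (position u) $ 2 = 0"
  "boundary_pos u < boundary_pos v \<Longrightarrow> u \<in> verts m n \<Longrightarrow> v \<in> verts m n \<Longrightarrow>
     bend (position u) $ 1 < bend (position v) $ 1"
proof -
  show "bend (position u) $ 2 = 0" by (cases u) auto
  assume *: "boundary_pos u < boundary_pos v" "u \<in> verts m n" "v \<in> verts m n"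
  show "bend (position u) $ 1 < bend (position v) $ 1"
  proof (cases u; cases v)
    fix x y assume "u = Upper x" "v = Lower y"
    moreover have "- exp (real x) < exp (real y)"
      using exp_gt_zero[of "real x"] exp_gt_zero[of "real y"] by linarith
    ultimately show ?thesis by simp
  qed (use * in \<open>auto simp: verts_def\<close>)
qed

text \<open>
  After bending, two interlaced blocks would be drawn by two paths in a rectangle with interlaced
  ends on its bottom side, and such paths meet by the Fashoda meet theorem.
\<close>

lemma planar_imp_noncrossing:
  assumes "planar a" and vert: "\<Union>a \<subseteq> verts m n"
  shows "noncrossing a"
  unfolding noncrossing_def
proof (intro allI impI notI)
  fix p q r s
  assume a: "{p, q} \<in> a" "{r, s} \<in> a"
    and ord: "boundary_pos p < boundary_pos r \<and> boundary_pos r < boundary_pos q \<and> boundary_pos q < boundary_pos s"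
  obtain \<gamma> where \<gamma>: "\<forall>B\<in>a. arc (\<gamma> B) \<and> {pathstart (\<gamma> B), pathfinish (\<gamma> B)} = position ` B
        \<and> path_image (\<gamma> B) \<subseteq> UNIV \<times> {0..1}"
    and disj: "\<forall>B\<in>a. \<forall>C\<in>a. B \<noteq> C \<longrightarrow> path_image (\<gamma> B) \<inter> path_image (\<gamma> C) = {}"
    using assms(1) unfolding planar_def by auto
  have neq: "{p, q} \<noteq> {r, s}" using ord by (auto simp: doubleton_eq_iff)
  have V: "p \<in> verts m n" "q \<in> verts m n" "r \<in> verts m n" "s \<in> verts m n"
    using a vert by auto
  have oriented: "\<exists>g. path g \<and> path_image g = path_image (\<gamma> {u, v})
      \<and> pathstart g = position u \<and> pathfinish g = position v" if "{u, v} \<in> a" for u v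
  proof -
    have "pathstart (\<gamma> {u, v}) = position u \<and> pathfinish (\<gamma> {u, v}) = position v
        \<or> pathstart (\<gamma> {u, v}) = position v \<and> pathfinish (\<gamma> {u, v}) = position u"
      using bspec[OF \<gamma> that] by (simp add: doubleton_eq_iff)
    moreover have "path (\<gamma> {u, v})" using \<gamma> that by (blast intro: arc_imp_path)
    ultimately show ?thesis
    proof (elim disjE conjE)
      assume "pathstart (\<gamma> {u, v}) = position v" "pathfinish (\<gamma> {u, v}) = position u" "path (\<gamma> {u, v})"
      thus ?thesis by (intro exI[of _ "reversepath (\<gamma> {u, v})"]) simp
    qed blast
  qed
  obtain f where f: "path f" "path_image f = path_image (\<gamma> {p, q})"
      "pathstart f = position p" "pathfinish f = position q" using oriented[OF a(1)] by blast
  obtain g where g: "path g" "path_image g = path_image (\<gamma> {r, s})"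
      "pathstart g = position r" "pathfinish g = position s" using oriented[OF a(2)] by blast
  let ?I = "bend ` (path_image f \<union> path_image g)"
  have strip: "path_image f \<union> path_image g \<subseteq> UNIV \<times> {0..1}"
    using \<gamma> a f(2) g(2) by simp
  have "compact ?I"
    by (intro compact_continuous_image continuous_on_bend compact_Un compact_path_image f g)
  then obtain R where R: "\<And>v. v \<in> ?I \<Longrightarrow> norm v \<le> R"
    using compact_imp_bounded[of ?I] unfolding bounded_iff by metis
  have box: "bend ` (path_image f \<union> path_image g) \<subseteq> cbox (vector [- R, 0]) (vector [R, R] :: real ^ 2)"
  proof
    fix v assume v: "v \<in> ?I"
    then obtain z where z: "z \<in> UNIV \<times> {0..1}" "v = bend z" using strip by blast
    have "\<bar>v $ 1\<bar> \<le> R" "\<bar>v $ 2\<bar> \<le> R"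
      using R[OF v] component_le_norm_cart order_trans by blast+
    moreover have "0 \<le> v $ 2" 
      using z by (auto intro!: mult_nonneg_nonneg sin_ge_zero simp: mult_left_le)
    ultimately show "v \<in> cbox (vector [- R, 0]) (vector [R, R] :: real ^ 2)"
      by (auto simp: mem_box_cart forall_2 abs_le_iff)
  qed
  have pf: "path (bend \<circ> f)" "path (bend \<circ> g)"
    using f(1) g(1) by (auto intro!: path_continuous_image continuous_on_bend)
  have img: "path_image (bend \<circ> f) \<subseteq> cbox (vector [- R, 0]) (vector [R, R] :: real ^ 2)"
      "path_image (bend \<circ> g) \<subseteq> cbox (vector [- R, 0]) (vector [R, R] :: real ^ 2)"
    using box unfolding path_image_compose image_Un by blast+
  have ends: "pathstart (bend \<circ> f) = bend (position p)" "pathfinish (bend \<circ> f) = bend (position q)"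
      "pathstart (bend \<circ> g) = bend (position r)" "pathfinish (bend \<circ> g) = bend (position s)"
    using f g by (simp_all add: pathstart_compose pathfinish_compose)
  obtain v where "v \<in> path_image (bend \<circ> f)" "v \<in> path_image (bend \<circ> g)"
    by (rule fashoda_interlace[OF pf img])
      (use ord V bend_position in \<open>simp_all add: ends del: bend_component\<close>)
  then obtain z w where zw: "z \<in> path_image f" "w \<in> path_image g" "bend z = bend w"
    unfolding path_image_compose by (elim imageE) metis
  have "z = w" using inj_onD[OF inj_on_bend zw(3)] zw(1,2) strip by blast
  moreover have "path_image f \<inter> path_image g = {}" using disj a neq f(2) g(2) by simp
  ultimately show False using zw(1,2) by blast
qed

lemma planar_diagram_id: "planar (diagram_id n)"
  unfolding planar_def
proof (intro exI conjI ballI impI)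
  define x where "x = (\<lambda>B. THE i. B = {Upper i, Lower i})"
  have x: "x {Upper i, Lower i} = i" for i
    unfolding x_def by (rule the_equality) (auto simp: doubleton_eq_iff)
  let ?\<gamma> = "\<lambda>B. linepath (real (x B), 0 :: real) (real (x B), 1)"
  have img: "path_image (?\<gamma> B) \<subseteq> {real (x B)} \<times> {0..1}" for B
    by (auto simp: closed_segment_def algebra_simps)
  fix B assume "B \<in> diagram_id n"
  then obtain i where B: "B = {Upper i, Lower i}" by (auto simp: diagram_id_def)
  show "arc (?\<gamma> B)" by (rule arc_linepath) simp
  show "{pathstart (?\<gamma> B), pathfinish (?\<gamma> B)} = position ` B" by (auto simp: B x)
  show "path_image (?\<gamma> B) \<subseteq> UNIV \<times> {0..1}" using img by auto
  fix C assume "C \<in> diagram_id n" "B \<noteq> C"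
  then obtain j where "C = {Upper j, Lower j}" "i \<noteq> j" using B by (auto simp: diagram_id_def)
  hence "x B \<noteq> x C" by (simp add: B x)
  thus "path_image (?\<gamma> B) \<inter> path_image (?\<gamma> C) = {}" using img[of B] img[of C] by auto
qed

section \<open>Drawing a product\<close>

lemma path_component_image_path:
  assumes "path g" "continuous_on UNIV f" "x \<in> path_image g" "y \<in> path_image g" "f ` path_image g \<subseteq> S"
  shows "path_component S (f x) (f y)"
proof -
  have "path_connected (f ` path_image g)"
    by (intro path_connected_continuous_image path_connected_path_image assms(1)
        continuous_on_subset[OF assms(2)]) simp
  hence "path_component (f ` path_image g) (f x) (f y)"
    using assms(3,4) by (simp add: path_connected_component)
  thus ?thesis by (rule path_component_of_subset[OF assms(5)])
qed

lemma product_connected_memD: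
  "(u, v) \<in> product_connected m n t a b \<Longrightarrow> u \<in> product_verts m n t \<and> v \<in> product_verts m n t"
  by (simp add: product_connected_def)

text \<open>
  The first drawing is squeezed into the top third of the strip and the second into the bottom third,
  and vertical segments in the middle third join the two copies of each middle vertex. The gap matters:
  an arc may touch the boundary of its strip at points that are no vertices, so drawings placed next to
  each other could meet there, whereas a vertical segment ends in a vertex and can only meet the arc
  that belongs to this vertex.
\<close>

lemma planar_diagram_product:
  assumes a: "pairing m n a" "planar a" and b: "pairing n t b" "planar b"
  shows "planar (diagram_product m n t a b)"
proof -
  obtain \<gamma> where \<gamma>: "\<forall>B\<in>a. arc (\<gamma> B) \<and> {pathstart (\<gamma> B), pathfinish (\<gamma> B)} = position ` B
        \<and> path_image (\<gamma> B) \<subseteq> UNIV \<times> {0..1}"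
    and \<gamma>_disj: "\<forall>B\<in>a. \<forall>C\<in>a. B \<noteq> C \<longrightarrow> path_image (\<gamma> B) \<inter> path_image (\<gamma> C) = {}"
    using a(2) unfolding planar_def by auto
  obtain \<eta> where \<eta>: "\<forall>B\<in>b. arc (\<eta> B) \<and> {pathstart (\<eta> B), pathfinish (\<eta> B)} = position ` B
        \<and> path_image (\<eta> B) \<subseteq> UNIV \<times> {0..1}"
    and \<eta>_disj: "\<forall>B\<in>b. \<forall>C\<in>b. B \<noteq> C \<longrightarrow> path_image (\<eta> B) \<inter> path_image (\<eta> C) = {}"
    using b(2) unfolding planar_def by auto
  define up low :: "real \<times> real \<Rightarrow> real \<times> real"
    where "up = (\<lambda>z. (fst z, (2 + snd z) / 3))" and "low = (\<lambda>z. (fst z, snd z / 3))"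
  define seg :: "nat \<Rightarrow> (real \<times> real) set" where "seg = (\<lambda>i. {real i} \<times> {1/3..2/3})"
  \<comment> \<open>The part of the stacked drawing that belongs to a set of vertices of the product graph.\<close>
  define region where "region C = (\<Union>B\<in>{B\<in>a. in_first ` B \<subseteq> C}. up ` path_image (\<gamma> B))
      \<union> (\<Union>B\<in>{B\<in>b. in_second ` B \<subseteq> C}. low ` path_image (\<eta> B))
      \<union> (\<Union>i\<in>{i\<in>{1..n}. Middle i \<in> C}. seg i)" for C
  have inj: "inj up" "inj low"
    by (auto simp: up_def low_def inj_def prod_eq_iff)
  have cont: "continuous_on S up" "continuous_on S low" for S
    unfolding up_def low_def by (intro continuous_intros; simp)+
  have up_range: "2/3 \<le> snd z" "snd z \<le> 1" if z: "z \<in> up ` path_image (\<gamma> B)" and B: "B \<in> a" for z B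
  proof -
    obtain w where "z = up w" "w \<in> path_image (\<gamma> B)" using z by (rule imageE)
    moreover from this have "w \<in> UNIV \<times> {0..1}" using bspec[OF \<gamma> B] by blast
    ultimately show "2/3 \<le> snd z" "snd z \<le> 1" by (auto simp: up_def)
  qed
  have low_range: "snd z \<le> 1/3" "0 \<le> snd z" if z: "z \<in> low ` path_image (\<eta> B)" and B: "B \<in> b" for z B
  proof -
    obtain w where "z = low w" "w \<in> path_image (\<eta> B)" using z by (rule imageE)
    moreover from this have "w \<in> UNIV \<times> {0..1}" using bspec[OF \<eta> B] by blast
    ultimately show "snd z \<le> 1/3" "0 \<le> snd z" by (auto simp: low_def)
  qed
  have ends_\<gamma>: "position p \<in> path_image (\<gamma> B)" if "B \<in> a" "p \<in> B" for p B
  proof -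
    have "position p \<in> {pathstart (\<gamma> B), pathfinish (\<gamma> B)}" using bspec[OF \<gamma> that(1)] that(2) by simp
    thus ?thesis by auto
  qed
  have ends_\<eta>: "position p \<in> path_image (\<eta> B)" if "B \<in> b" "p \<in> B" for p B
  proof -
    have "position p \<in> {pathstart (\<eta> B), pathfinish (\<eta> B)}" using bspec[OF \<eta> that(1)] that(2) by simp
    thus ?thesis by auto
  qed
  have seg_up: "Lower i \<in> B" if B: "B \<in> a" and z: "z \<in> up ` path_image (\<gamma> B)" "z \<in> seg i" and i: "i \<in> {1..n}" for z i B
  proof -
    have "z = (real i, 2/3)" using up_range(1)[OF z(1) B] z(2) by (auto simp: seg_def)
    also have "\<dots> = up (position (Lower i))" by (simp add: up_def)
    finally have "position (Lower i) \<in> path_image (\<gamma> B)" using z(1) inj(1) by (simp add: inj_image_mem_iff)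
    moreover have "Lower i \<in> \<Union>a" using i pairingD(1)[OF a(1)] by (simp add: verts_def)
    then obtain B' where B': "B' \<in> a" "Lower i \<in> B'" by blast
    ultimately have "B = B'" using ends_\<gamma>[OF B'] \<gamma>_disj B by blast
    thus ?thesis using B' by simp
  qed
  have seg_low: "Upper i \<in> B" if B: "B \<in> b" and z: "z \<in> low ` path_image (\<eta> B)" "z \<in> seg i" and i: "i \<in> {1..n}" for z i B
  proof -
    have "z = (real i, 1/3)" using low_range(1)[OF z(1) B] z(2) by (auto simp: seg_def)
    also have "\<dots> = low (position (Upper i))" by (simp add: low_def)
    finally have "position (Upper i) \<in> path_image (\<eta> B)" using z(1) inj(2) by (simp add: inj_image_mem_iff)
    moreover have "Upper i \<in> \<Union>b" using i pairingD(1)[OF b(1)] by (simp add: verts_def)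
    then obtain B' where B': "B' \<in> b" "Upper i \<in> B'" by blast
    ultimately have "B = B'" using ends_\<eta>[OF B'] \<eta>_disj B by blast
    thus ?thesis using B' by simp
  qed
  have region_cases: "(\<exists>B\<in>a. in_first ` B \<subseteq> C \<and> z \<in> up ` path_image (\<gamma> B))
      \<or> (\<exists>B\<in>b. in_second ` B \<subseteq> C \<and> z \<in> low ` path_image (\<eta> B))
      \<or> (\<exists>i\<in>{1..n}. Middle i \<in> C \<and> z \<in> seg i)" if "z \<in> region C" for z C
    using that unfolding region_def by blast
  have nonempty: "B \<noteq> {}" if "B \<in> a \<or> B \<in> b" for B
    using that pairingD(3)[OF a(1)] pairingD(3)[OF b(1)] by fastforce
  have region_meet: "C \<inter> C' \<noteq> {}" if z: "z \<in> region C" "z \<in> region C'" for z C C'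
  proof -
    have up_low: False if "B \<in> a" "z \<in> up ` path_image (\<gamma> B)" "B' \<in> b" "z \<in> low ` path_image (\<eta> B')" for B B'
      using up_range(1)[OF that(2,1)] low_range(1)[OF that(4,3)] by simp
    have up_up: "B = B'" if "B \<in> a" "z \<in> up ` path_image (\<gamma> B)" "B' \<in> a" "z \<in> up ` path_image (\<gamma> B')" for B B'
    proof -
      have "z \<in> up ` (path_image (\<gamma> B) \<inter> path_image (\<gamma> B'))" using that(2,4) by (simp add: image_Int[OF inj(1)])
      thus ?thesis using \<gamma>_disj that(1,3) by fastforce
    qed
    have low_low: "B = B'" if "B \<in> b" "z \<in> low ` path_image (\<eta> B)" "B' \<in> b" "z \<in> low ` path_image (\<eta> B')" for B B'
    proof -
      have "z \<in> low ` (path_image (\<eta> B) \<inter> path_image (\<eta> B'))" using that(2,4) by (simp add: image_Int[OF inj(2)])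
      thus ?thesis using \<eta>_disj that(1,3) by fastforce
    qed
    have up_seg: "Middle i \<in> in_first ` B" if "B \<in> a" "z \<in> up ` path_image (\<gamma> B)" "i \<in> {1..n}" "z \<in> seg i" for B i
      using seg_up[OF that(1,2,4,3)] by force
    have low_seg: "Middle i \<in> in_second ` B" if "B \<in> b" "z \<in> low ` path_image (\<eta> B)" "i \<in> {1..n}" "z \<in> seg i" for B i
      using seg_low[OF that(1,2,4,3)] by force
    have seg_seg: "i = j" if "z \<in> seg i" "z \<in> seg j" for i j
      using that by (auto simp: seg_def)
    consider (upper) B where "B \<in> a" "in_first ` B \<subseteq> C" "z \<in> up ` path_image (\<gamma> B)"
      | (lower) B where "B \<in> b" "in_second ` B \<subseteq> C" "z \<in> low ` path_image (\<eta> B)"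
      | (middle) i where "i \<in> {1..n}" "Middle i \<in> C" "z \<in> seg i"
      using region_cases[OF z(1)] by blast
    thus ?thesis
    proof cases
      case (upper B)
      consider (upper') B' where "B' \<in> a" "in_first ` B' \<subseteq> C'" "z \<in> up ` path_image (\<gamma> B')"
      | (lower') B' where "B' \<in> b" "in_second ` B' \<subseteq> C'" "z \<in> low ` path_image (\<eta> B')"
      | (middle') j where "j \<in> {1..n}" "Middle j \<in> C'" "z \<in> seg j"
      using region_cases[OF z(2)] by blast
      thus ?thesis
      proof cases
        case (upper' B') thus ?thesis using up_up[OF upper(1,3) upper'(1,3)] nonempty[of B] upper(1,2) upper'(2) by blast
      next
        case (lower' B') thus ?thesis using up_low[OF upper(1,3) lower'(1,3)] by blast
      next
        case (middle' j) thus ?thesis using up_seg[OF upper(1,3) middle'(1,3)] upper(2) middle'(2) by blast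
      qed
    next
      case (lower B)
      consider (upper') B' where "B' \<in> a" "in_first ` B' \<subseteq> C'" "z \<in> up ` path_image (\<gamma> B')"
      | (lower') B' where "B' \<in> b" "in_second ` B' \<subseteq> C'" "z \<in> low ` path_image (\<eta> B')"
      | (middle') j where "j \<in> {1..n}" "Middle j \<in> C'" "z \<in> seg j"
      using region_cases[OF z(2)] by blast
      thus ?thesis
      proof cases
        case (upper' B') thus ?thesis using up_low[OF upper'(1,3) lower(1,3)] by blast
      next
        case (lower' B') thus ?thesis using low_low[OF lower(1,3) lower'(1,3)] nonempty[of B] lower(1,2) lower'(2) by blast
      next
        case (middle' j) thus ?thesis using low_seg[OF lower(1,3) middle'(1,3)] lower(2) middle'(2) by blast
      qed
    next
      case (middle i)
      consider (upper') B' where "B' \<in> a" "in_first ` B' \<subseteq> C'" "z \<in> up ` path_image (\<gamma> B')"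
      | (lower') B' where "B' \<in> b" "in_second ` B' \<subseteq> C'" "z \<in> low ` path_image (\<eta> B')"
      | (middle') j where "j \<in> {1..n}" "Middle j \<in> C'" "z \<in> seg j"
      using region_cases[OF z(2)] by blast
      thus ?thesis
      proof cases
        case (upper' B') thus ?thesis using up_seg[OF upper'(1,3) middle(1,3)] upper'(2) middle(2) by blast
      next
        case (lower' B') thus ?thesis using low_seg[OF lower'(1,3) middle(1,3)] lower'(2) middle(2) by blast
      next
        case (middle' j) thus ?thesis using seg_seg[OF middle(3) middle'(3)] middle(2) middle'(2) by blast
      qed
    qed
  qed
  have region_strip: "region C \<subseteq> UNIV \<times> {0..1}" for C
  proof
    fix z assume "z \<in> region C"
    from region_cases[OF this] have "0 \<le> snd z \<and> snd z \<le> 1"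
    proof (elim disjE bexE conjE, goal_cases)
      case (1 B) then show ?case using up_range[of z B] by simp
    next
      case (2 B) then show ?case using low_range[of z B] by simp
    next
      case (3 i) then show ?case by (auto simp: seg_def)
    qed
    thus "z \<in> UNIV \<times> {0..1}" by (simp add: mem_Times_iff)
  qed
  \<comment> \<open>A middle vertex is placed where the first drawing ends.\<close>
  define point :: "product_vertex \<Rightarrow> real \<times> real" where
    "point u = (case u of Top x \<Rightarrow> (real x, 1) | Middle x \<Rightarrow> (real x, 2/3) | Bottom x \<Rightarrow> (real x, 0))" for u
  have point_first: "point (in_first p) = up (position p)" for p
    by (cases p) (simp_all add: point_def up_def)
  have point_product: "point (in_product p) = position p" for p
    by (cases p) (simp_all add: point_def)
  let ?V = "product_verts m n t"
  note U = edges_verts[OF pairingD(1)[OF a(1)] pairingD(1)[OF b(1)]]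
  have point_second: "path_component (region C) (point (in_second p)) (low (position p))"
    if "in_second p \<in> C" "p \<in> verts n t" "B \<in> b" "p \<in> B" "in_second ` B \<subseteq> C" for p C B
  proof (cases p)
    case (Upper x)
    hence "seg x \<subseteq> region C" using that unfolding region_def verts_def by auto
    moreover have "path_connected (seg x)"
      unfolding seg_def by (intro convex_imp_path_connected convex_Times) auto
    moreover have "point (in_second p) \<in> seg x" "low (position p) \<in> seg x"
      by (auto simp: Upper point_def low_def seg_def)
    ultimately show ?thesis by (meson path_component_of_subset path_connected_component)
  next
    case (Lower x)
    hence "point (in_second p) = low (position p)" by (simp add: point_def low_def)
    moreover have "low (position p) \<in> region C" using that ends_\<eta>[OF that(3,4)] unfolding region_def by blast
    ultimately show ?thesis by (simp add: path_component_refl)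
  qed
  have edge: "path_component (region C) (point u) (point v)"
    if uv: "{u, v} \<in> product_edges a b" "{u, v} \<subseteq> C" for u v C
  proof -
    from uv(1) consider B where "B \<in> a" "{u, v} = in_first ` B" | B where "B \<in> b" "{u, v} = in_second ` B"
      unfolding product_edges_def by blast
    thus ?thesis
    proof cases
      case (1 B)
      have "u \<in> in_first ` B" "v \<in> in_first ` B" using 1(2) by auto
      then obtain p q where pq: "p \<in> B" "u = in_first p" "q \<in> B" "v = in_first q" by blast
      have "up ` path_image (\<gamma> B) \<subseteq> region C" using 1 uv(2) unfolding region_def by blast
      moreover have "path (\<gamma> B)" using \<gamma> 1 by (blast intro: arc_imp_path)
      ultimately show ?thesis unfolding pq point_first
        using ends_\<gamma> 1(1) pq by (intro path_component_image_path[OF _ cont(1)]) auto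
    next
      case (2 B)
      have "u \<in> in_second ` B" "v \<in> in_second ` B" using 2(2) by auto
      then obtain p q where pq: "p \<in> B" "u = in_second p" "q \<in> B" "v = in_second q" by blast
      have sub: "low ` path_image (\<eta> B) \<subseteq> region C" using 2 uv(2) unfolding region_def by blast
      have "path (\<eta> B)" using \<eta> 2 by (blast intro: arc_imp_path)
      hence "path_component (region C) (low (position p)) (low (position q))"
        using ends_\<eta> 2(1) pq sub by (intro path_component_image_path[OF _ cont(2)]) auto
      moreover have "p \<in> verts n t" "q \<in> verts n t" using pairingD(1)[OF b(1)] 2 pq by blast+
      ultimately show ?thesis
        using point_second[of p C B] point_second[of q C B] uv(2) 2 pq
        by (metis insert_subset path_component_sym path_component_trans)
    qed
  qed
  let ?R = "product_connected m n t a b"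
  have connected: "path_component (region (?R `` {u})) (point u) (point v)"
    if uv: "(u, v) \<in> ?R" and B: "\<exists>B\<in>product_edges a b. u \<in> B" for u v
  proof -
    have u: "u \<in> ?V" using product_connected_memD[OF uv] by simp
    note cls = product_connected_class[OF pairingD(1)[OF a(1)] pairingD(1)[OF b(1)] u]
    obtain B where B: "B \<in> product_edges a b" "u \<in> B" using B by blast
    have "(u, v) \<in> (product_adjacent a b)\<^sup>*" using uv by (simp add: product_connected_def)
    thus ?thesis
    proof (induction rule: rtrancl_induct)
      case base
      have "card B = 2" using B(1) pairingD(3)[OF a(1)] pairingD(3)[OF b(1)]
        by (auto simp: product_edges_def card_image inj_on_subset[OF inj_in(1)] inj_on_subset[OF inj_in(2)])
      then obtain w where w: "B = {u, w}" using B(2) by (auto simp: card_2_iff)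
      have "w \<in> ?R `` {u}" unfolding cls using w B(1) by auto
      moreover have "u \<in> ?R `` {u}" unfolding cls by auto
      ultimately have "path_component (region (?R `` {u})) (point u) (point w)"
        using edge[of u w] w B(1) by blast
      thus ?case using path_component_mem(1) path_component_refl by blast
    next
      case (step v w)
      have "v \<in> ?R `` {u}" "w \<in> ?R `` {u}" unfolding cls
        using step(1,2) by (auto intro: rtrancl_into_rtrancl)
      hence "path_component (region (?R `` {u})) (point v) (point w)"
        using edge[of v w] step(2) by blast
      thus ?case using step.IH path_component_trans by blast
    qed
  qed
  have "\<exists>g. arc g \<and> {pathstart g, pathfinish g} = position ` D
      \<and> path_image g \<subseteq> region (?R `` (in_product ` D))" if D: "D \<in> diagram_product m n t a b" for D
  proof -
    note pD = pairing_diagram_product[OF a(1) b(1)]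
    obtain x where x: "x \<in> verts m t" "D = outer_connected m n t a b `` {x}"
      using D unfolding diagram_product_eq by (auto elim: quotientE)
    have "x \<in> D" using x equiv_class_self[OF outer_connected_equiv] by simp
    then obtain y where y: "D = {x, y}" "x \<noteq> y" using pairingD(3)[OF pD D] by (auto simp: card_2_iff)
    have xy: "(in_product x, in_product y) \<in> ?R" using y(1) x(2) unfolding outer_connected_def by blast
    have "in_product x \<in> \<Union>(product_edges a b)" unfolding U(3) using x(1) by simp
    hence "path_component (region (?R `` {in_product x})) (position x) (position y)"
      using connected[OF xy] by (auto simp: point_product)
    then obtain g where g: "path g" "path_image g \<subseteq> region (?R `` {in_product x})"
        "pathstart g = position x" "pathfinish g = position y"
      unfolding path_component_def by blast
    have "position x \<noteq> position y" using y(2) by (cases x; cases y) auto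
    with g obtain h where "arc h" "path_image h \<subseteq> path_image g"
        "pathstart h = position x" "pathfinish h = position y"
      using path_contains_arc[OF g(1,3,4)] by blast
    moreover have "?R `` {in_product x} = ?R `` (in_product ` D)"
      using equiv_class_eq[OF product_connected_equiv xy] y(1) by auto
    ultimately show ?thesis using g(2) y(1) by (intro exI[of _ h]) auto
  qed
  then obtain \<theta> where \<theta>: "\<And>D. D \<in> diagram_product m n t a b \<Longrightarrow> arc (\<theta> D) \<and> {pathstart (\<theta> D), pathfinish (\<theta> D)} = position ` D
      \<and> path_image (\<theta> D) \<subseteq> region (?R `` (in_product ` D))"
    by metis
  have disj: "path_image (\<theta> D) \<inter> path_image (\<theta> D') = {}"
    if D: "D \<in> diagram_product m n t a b" "D' \<in> diagram_product m n t a b" "D \<noteq> D'" for D D'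
  proof (rule ccontr)
    assume "path_image (\<theta> D) \<inter> path_image (\<theta> D') \<noteq> {}"
    then obtain z where "z \<in> region (?R `` (in_product ` D))" "z \<in> region (?R `` (in_product ` D'))"
      using \<theta>[OF D(1)] \<theta>[OF D(2)] by blast
    from region_meet[OF this] obtain x y v where xy: "x \<in> D" "y \<in> D'"
        "(in_product x, v) \<in> ?R" "(in_product y, v) \<in> ?R" by blast
    have "(in_product x, in_product y) \<in> ?R"
      using xy(3,4) symD[OF equiv_imp_sym[OF product_connected_equiv]] transD[OF equiv_imp_trans[OF product_connected_equiv]] by metis
    hence "(x, y) \<in> outer_connected m n t a b"
      using product_connected_memD[of "in_product x" "in_product y"] by (simp add: outer_connected_def)
    hence "D = D'"
      using quotient_eqI[OF outer_connected_equiv _ _ xy(1,2)] D(1,2) unfolding diagram_product_eq by blast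
    thus False using D(3) by simp
  qed
  show ?thesis
    unfolding planar_def
    using \<theta> disj region_strip by (intro exI[of _ \<theta>] conjI ballI impI) (blast+)
qed

section \<open>Products of diagram matrices\<close>

abbreviation block_union :: "'a set set \<Rightarrow> 'a set \<Rightarrow> bool" where
  "block_union a S \<equiv> \<exists>T\<subseteq>a. \<Union>T = S"

lemma block_union_iff:
  assumes "disjoint a"
  shows "block_union a S \<longleftrightarrow> S \<subseteq> \<Union>a \<and> (\<forall>B\<in>a. B \<subseteq> S \<or> B \<inter> S = {})"
proof (intro iffI conjI ballI)
  assume "block_union a S"
  then obtain T where T: "T \<subseteq> a" "\<Union>T = S" by blast
  thus "S \<subseteq> \<Union>a" by blast
  fix B assume B: "B \<in> a"
  show "B \<subseteq> S \<or> B \<inter> S = {}"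
  proof (cases "B \<in> T")
    case False
    hence "B \<inter> C = {}" if "C \<in> T" for C using that disjointD[OF assms B, of C] T(1) by blast
    thus ?thesis using T(2) by blast
  qed (use T in blast)
next
  assume S: "S \<subseteq> \<Union>a \<and> (\<forall>B\<in>a. B \<subseteq> S \<or> B \<inter> S = {})"
  have "x \<in> \<Union>{B \<in> a. B \<subseteq> S}" if "x \<in> S" for x
  proof -
    have "x \<in> \<Union>a" using S[THEN conjunct1] that by (rule subsetD)
    thus ?thesis using S that by fast
  qed
  hence "\<Union>{B \<in> a. B \<subseteq> S} = S" by (intro equalityI subsetI) auto
  thus "block_union a S" by (intro exI[of _ "{B \<in> a. B \<subseteq> S}"]) simp
qed

definition vertex_set :: "nat set \<Rightarrow> nat set \<Rightarrow> vertex set" where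
  "vertex_set X Y = Upper ` X \<union> Lower ` Y"

lemma vertex_set_mem [simp]:
  "Upper x \<in> vertex_set X Y \<longleftrightarrow> x \<in> X" "Lower y \<in> vertex_set X Y \<longleftrightarrow> y \<in> Y"
  by (auto simp: vertex_set_def)

lemma vertex_set_subset: "X \<subseteq> {1..m} \<Longrightarrow> Y \<subseteq> {1..n} \<Longrightarrow> vertex_set X Y \<subseteq> verts m n"
  by (auto simp: vertex_set_def verts_def)

lemma subset_index_less: "X \<subseteq> {1..n} \<Longrightarrow> subset_index n X < 2 ^ n"
  using bij_betw_subset_index[of n] by (auto simp: bij_betw_def)

lemma subset_at_index [simp]: "X \<subseteq> {1..n} \<Longrightarrow> subset_at n (subset_index n X) = X"
  using bij_betw_subset_index[of n] unfolding subset_at_def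
  by (intro the_inv_into_f_f) (auto simp: bij_betw_def)

lemma index_of_subset:
  assumes "i < 2 ^ n" obtains X where "X \<subseteq> {1..n}" "i = subset_index n X"
  using bij_betw_subset_index[of n] assms unfolding bij_betw_def by auto

lemma diagram_matrix_carrier [simp]: "diagram_matrix m n a \<in> carrier_mat (2 ^ m) (2 ^ n)"
  by (simp add: diagram_matrix_def)

lemma diagram_matrix_entry:
  assumes "X \<subseteq> {1..m}" "Y \<subseteq> {1..n}"
  shows "diagram_matrix m n a $$ (subset_index m X, subset_index n Y)
     = of_bool (block_union a (vertex_set X Y))"
  using assms by (simp add: diagram_matrix_def subset_index_less vertex_set_def)

lemma eq_mat_subsetsI:
  assumes "A \<in> carrier_mat (2 ^ m) (2 ^ n)" "B \<in> carrier_mat (2 ^ m) (2 ^ n)"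
    and "\<And>X Y. X \<subseteq> {1..m} \<Longrightarrow> Y \<subseteq> {1..n} \<Longrightarrow>
      A $$ (subset_index m X, subset_index n Y) = B $$ (subset_index m X, subset_index n Y)"
  shows "A = B"
proof (rule eq_matI)
  fix i j assume "i < dim_row B" "j < dim_col B"
  hence "i < 2 ^ m" "j < 2 ^ n" using assms(2) by auto
  thus "A $$ (i, j) = B $$ (i, j)" using assms(3) by (metis index_of_subset)
qed (use assms(1,2) in auto)

lemma mult_mat_subsets:
  fixes A B :: "'k::field mat"
  assumes "A \<in> carrier_mat (2 ^ m) (2 ^ n)" "B \<in> carrier_mat (2 ^ n) (2 ^ t)"
    and "X \<subseteq> {1..m}" "Z \<subseteq> {1..t}"
  shows "(A * B) $$ (subset_index m X, subset_index t Z) =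
    (\<Sum>Y\<in>Pow {1..n}. A $$ (subset_index m X, subset_index n Y) * B $$ (subset_index n Y, subset_index t Z))"
proof -
  have "(A * B) $$ (subset_index m X, subset_index t Z)
      = (\<Sum>k\<in>{..<2 ^ n}. A $$ (subset_index m X, k) * B $$ (k, subset_index t Z))"
    using assms subset_index_less[of X m] subset_index_less[of Z t]
    by (auto simp: scalar_prod_def atLeast0LessThan intro!: sum.cong)
  also have "\<dots> = (\<Sum>Y\<in>Pow {1..n}. A $$ (subset_index m X, subset_index n Y) * B $$ (subset_index n Y, subset_index t Z))"
    by (rule sum.reindex_bij_betw[OF bij_betw_subset_index, symmetric])
  finally show ?thesis .
qed

definition product_set :: "nat set \<Rightarrow> nat set \<Rightarrow> nat set \<Rightarrow> product_vertex set" where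
  "product_set X Y Z = Top ` X \<union> Middle ` Y \<union> Bottom ` Z"

lemma product_set_mem [simp]:
  "in_first p \<in> product_set X Y Z \<longleftrightarrow> p \<in> vertex_set X Y"
  "in_second p \<in> product_set X Y Z \<longleftrightarrow> p \<in> vertex_set Y Z"
  "in_product p \<in> product_set X Y Z \<longleftrightarrow> p \<in> vertex_set X Z"
  by (cases p; auto simp: product_set_def)+

lemma respects_pairs_image_iff:
  assumes "\<And>B. B \<in> a \<Longrightarrow> card B = 2" "\<And>p. f p \<in> W \<longleftrightarrow> p \<in> S"
  shows "(\<forall>B\<in>a. B \<subseteq> S \<or> B \<inter> S = {}) \<longleftrightarrow> (\<forall>u v. {u, v} \<in> (\<lambda>B. f ` B) ` a \<longrightarrow> u \<in> W \<longrightarrow> v \<in> W)"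
    (is "?L \<longleftrightarrow> ?R")
proof
  assume L: ?L
  show ?R
  proof (intro allI impI)
    fix u v assume "{u, v} \<in> (\<lambda>B. f ` B) ` a" and u: "u \<in> W"
    then obtain B where B: "B \<in> a" "{u, v} = f ` B" by blast
    hence "u \<in> f ` B" "v \<in> f ` B" by auto
    then obtain p q where pq: "p \<in> B" "u = f p" "q \<in> B" "v = f q" by blast
    hence "B \<subseteq> S" using L B(1) u assms(2) by blast
    thus "v \<in> W" using pq assms(2) by blast
  qed
next
  assume R: ?R
  show ?L
  proof
    fix B assume B: "B \<in> a"
    then obtain p q where pq: "B = {p, q}" using assms(1)[OF B] by (auto simp: card_2_iff)
    have "{f p, f q} \<in> (\<lambda>B. f ` B) ` a" using B by (intro image_eqI[of _ _ B]) (auto simp: pq)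
    moreover from this have "{f q, f p} \<in> (\<lambda>B. f ` B) ` a" by (simp add: insert_commute)
    ultimately have "p \<in> S \<longleftrightarrow> q \<in> S" using R assms(2) by metis
    thus "B \<subseteq> S \<or> B \<inter> S = {}" by (auto simp: pq)
  qed
qed

text \<open>
  Both conditions say that no edge of the product graph leaves \<open>X \<union> Y'' \<union> Z'\<close>.
\<close>

lemma product_set_closed_iff:
  assumes a: "pairing m n a" and b: "pairing n t b"
    and XYZ: "X \<subseteq> {1..m}" "Y \<subseteq> {1..n}" "Z \<subseteq> {1..t}"
  shows "block_union a (vertex_set X Y) \<and> block_union b (vertex_set Y Z)
    \<longleftrightarrow> product_connected m n t a b `` product_set X Y Z \<subseteq> product_set X Y Z" (is "?L \<longleftrightarrow> ?R")
proof -
  let ?W = "product_set X Y Z"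
  note U = pairingD(1)[OF a] pairingD(1)[OF b]
  have R: "?R \<longleftrightarrow> product_adjacent a b `` ?W \<subseteq> ?W"
  proof
    assume R: ?R
    have "(u, v) \<in> product_connected m n t a b" if "{u, v} \<in> product_edges a b" for u v
    proof -
      have "u \<in> product_verts m n t" "v \<in> product_verts m n t" using that edges_verts(3)[OF U] by blast+
      thus ?thesis using that by (auto simp: product_connected_def)
    qed
    thus "product_adjacent a b `` ?W \<subseteq> ?W" using R by blast
  next
    assume "product_adjacent a b `` ?W \<subseteq> ?W"
    hence "(product_adjacent a b)\<^sup>* `` ?W = ?W" by (rule Image_closed_trancl)
    thus ?R by (auto simp: product_connected_def)
  qed
  have L: "block_union a (vertex_set X Y) \<longleftrightarrow> (\<forall>B\<in>a. B \<subseteq> vertex_set X Y \<or> B \<inter> vertex_set X Y = {})"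
    "block_union b (vertex_set Y Z) \<longleftrightarrow> (\<forall>B\<in>b. B \<subseteq> vertex_set Y Z \<or> B \<inter> vertex_set Y Z = {})"
    using block_union_iff[OF pairingD(2)[OF a]] block_union_iff[OF pairingD(2)[OF b]] U
      vertex_set_subset[OF XYZ(1,2)] vertex_set_subset[OF XYZ(2,3)] by auto
  have fst: "(\<forall>B\<in>a. B \<subseteq> vertex_set X Y \<or> B \<inter> vertex_set X Y = {})
      \<longleftrightarrow> (\<forall>u v. {u, v} \<in> (\<lambda>B. in_first ` B) ` a \<longrightarrow> u \<in> ?W \<longrightarrow> v \<in> ?W)"
    by (rule respects_pairs_image_iff) (use pairingD(3)[OF a] in auto)
  have snd: "(\<forall>B\<in>b. B \<subseteq> vertex_set Y Z \<or> B \<inter> vertex_set Y Z = {})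
      \<longleftrightarrow> (\<forall>u v. {u, v} \<in> (\<lambda>B. in_second ` B) ` b \<longrightarrow> u \<in> ?W \<longrightarrow> v \<in> ?W)"
    by (rule respects_pairs_image_iff) (use pairingD(3)[OF b] in auto)
  have adjacent: "{(x, y). {x, y} \<in> P \<union> Q} `` W \<subseteq> W \<longleftrightarrow>
      (\<forall>u v. {u, v} \<in> P \<longrightarrow> u \<in> W \<longrightarrow> v \<in> W) \<and> (\<forall>u v. {u, v} \<in> Q \<longrightarrow> u \<in> W \<longrightarrow> v \<in> W)"
    for P Q :: "'a set set" and W
    by blast
  show ?thesis unfolding R L fst snd product_edges_def adjacent ..
qed

text \<open>
  If the outer part \<open>(X, Z)\<close> is a union of blocks of the product, the components that meet it are
  forced, those that meet its complement are excluded, and the sets \<open>Y\<close> correspond to arbitrary sets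
  of floating components. If it is not, some component has one outer vertex in \<open>(X, Z)\<close> and one
  outside, and no \<open>Y\<close> exists.
\<close>

lemma card_middle_subsets:
  assumes a: "pairing m n a" and b: "pairing n t b" and XZ: "X \<subseteq> {1..m}" "Z \<subseteq> {1..t}"
  shows "card {Y \<in> Pow {1..n}. block_union a (vertex_set X Y) \<and> block_union b (vertex_set Y Z)}
    = (if block_union (diagram_product m n t a b) (vertex_set X Z) then 2 ^ floating m n t a b else 0)"
proof -
  let ?V = "product_verts m n t" and ?R = "product_connected m n t a b"
  let ?W = "\<lambda>Y. product_set X Y Z"
  define good where "good = {Y \<in> Pow {1..n}. ?R `` ?W Y \<subseteq> ?W Y}"
  note eqv = product_connected_equiv[of m n t a b]
  note symR = symD[OF equiv_imp_sym[OF eqv]] and transR = transD[OF equiv_imp_trans[OF eqv]]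
  have good: "{Y \<in> Pow {1..n}. block_union a (vertex_set X Y) \<and> block_union b (vertex_set Y Z)} = good"
    unfolding good_def
    by (intro Collect_cong conj_cong refl product_set_closed_iff[OF a b XZ(1) _ XZ(2)]) simp
  have outer: "block_union (diagram_product m n t a b) (vertex_set X Z) \<longleftrightarrow>
      (\<forall>x y. (x, y) \<in> outer_connected m n t a b \<longrightarrow> x \<in> vertex_set X Z \<longrightarrow> y \<in> vertex_set X Z)" (is "?L \<longleftrightarrow> ?O")
  proof -
    note p = pairing_diagram_product[OF a b]
    note eqo = outer_connected_equiv[of m t n a b]
    have "?L \<longleftrightarrow> (\<forall>B\<in>diagram_product m n t a b. B \<subseteq> vertex_set X Z \<or> B \<inter> vertex_set X Z = {})"
      using block_union_iff[OF pairingD(2)[OF p]] pairingD(1)[OF p] vertex_set_subset[OF XZ] by auto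
    also have "\<dots> \<longleftrightarrow> ?O"
    proof
      assume L: "\<forall>B\<in>diagram_product m n t a b. B \<subseteq> vertex_set X Z \<or> B \<inter> vertex_set X Z = {}"
      show ?O
      proof (intro allI impI)
        fix x y assume xy: "(x, y) \<in> outer_connected m n t a b" "x \<in> vertex_set X Z"
        have x: "x \<in> verts m t" using xy(1) by (simp add: outer_connected_def)
        hence "outer_connected m n t a b `` {x} \<in> diagram_product m n t a b"
          unfolding diagram_product_eq by (rule quotientI)
        moreover have "x \<in> outer_connected m n t a b `` {x}" using equiv_class_self[OF eqo x] .
        ultimately have "outer_connected m n t a b `` {x} \<subseteq> vertex_set X Z" using L xy(2) by blast
        thus "y \<in> vertex_set X Z" using xy(1) by blast
      qed
    next
      assume O: ?O
      show "\<forall>B\<in>diagram_product m n t a b. B \<subseteq> vertex_set X Z \<or> B \<inter> vertex_set X Z = {}"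
      proof
        fix B assume "B \<in> diagram_product m n t a b"
        hence "(x, y) \<in> outer_connected m n t a b" if "x \<in> B" "y \<in> B" for x y
          using quotient_eq_iff[OF eqo _ _ that] unfolding diagram_product_eq by blast
        thus "B \<subseteq> vertex_set X Z \<or> B \<inter> vertex_set X Z = {}" using O by blast
      qed
    qed
    finally show ?thesis .
  qed
  show ?thesis
  proof (cases ?L)
    case False
    then obtain x y where xy: "(x, y) \<in> outer_connected m n t a b" "x \<in> vertex_set X Z" "y \<notin> vertex_set X Z"
      using outer by blast
    have "(in_product x, in_product y) \<in> ?R" using xy(1) by (simp add: outer_connected_def)
    hence "\<not> ?R `` ?W Y \<subseteq> ?W Y" for Y
      using xy(2,3) product_set_mem(3)[of x X Y Z] product_set_mem(3)[of y X Y Z] by blast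
    thus ?thesis using False unfolding good good_def by simp
  next
    case True
    define Out where "Out = Top ` X \<union> Bottom ` Z"
    define base where "base = ?R `` Out"
    define Fl where "Fl = {C \<in> ?V // ?R. C \<subseteq> Middle ` {1..n}}"
    define M where "M F = {y. Middle y \<in> base \<union> \<Union>F}" for F
    have OutV: "Out \<subseteq> ?V" using XZ by (auto simp: Out_def product_verts_def)
    have Out: "u \<in> Out \<longleftrightarrow> u \<in> ?W Y \<and> u \<notin> range Middle" for u Y
      by (cases u) (auto simp: Out_def product_set_def)
    have refl: "(u, u) \<in> ?R" if "u \<in> ?V" for u
      using refl_onD[OF equiv_imp_refl[OF eqv] that] .
    have base_Out: "base - range Middle = Out"
    proof
      show "Out \<subseteq> base - range Middle" using OutV refl Out unfolding base_def by blast
      show "base - range Middle \<subseteq> Out"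
      proof
        fix v assume v: "v \<in> base - range Middle"
        then obtain u where u: "u \<in> Out" "(u, v) \<in> ?R" unfolding base_def by blast
        obtain x where x: "u = in_product x"
          using u(1) unfolding Out_def by (metis UnE imageE in_product.simps)
        obtain y where y: "v = in_product y"
          using v by (cases v) (metis in_product.simps(1), blast, metis in_product.simps(2))
        have "x \<in> vertex_set X Z" using u(1) Out[of u "{}"] x by simp
        moreover have "(x, y) \<in> outer_connected m n t a b"
          using u(2) product_connected_equiv[of m n t a b] by (auto simp: outer_connected_def x y equiv_def)
        ultimately have "y \<in> vertex_set X Z" using True outer by blast
        thus "v \<in> Out" using Out[of v "{}"] v y by simp
      qed
    qed
    have base_V: "base \<subseteq> ?V" unfolding base_def product_connected_def by blast
    have Fl_mid: "\<Union>F \<subseteq> Middle ` {1..n}" if "F \<subseteq> Fl" for F using that unfolding Fl_def by blast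
    have W_M: "?W (M F) = base \<union> \<Union>F" if F: "F \<subseteq> Fl" for F
    proof (rule Set.set_eqI)
      fix u show "u \<in> ?W (M F) \<longleftrightarrow> u \<in> base \<union> \<Union>F"
      proof (cases "u \<in> range Middle")
        case True thus ?thesis by (auto simp: M_def product_set_def)
      next
        case False
        thus ?thesis using Out[of u "M F"] base_Out Fl_mid[OF F] by blast
      qed
    qed
    have cls: "v \<in> C" if "C \<in> ?V // ?R" "u \<in> C" "(u, v) \<in> ?R" for C u v
      using in_quotient_imp_closed[OF eqv that] .
    have bij: "bij_betw M (Pow Fl) good"
    proof (rule bij_betwI')
      fix F G assume FG: "F \<in> Pow Fl" "G \<in> Pow Fl"
      \<comment> \<open>A floating component is disjoint from the base and from all other components, so the
        floating components in the union can be read off.\<close>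
      have recover: "F = {C \<in> Fl. C \<inter> (base \<union> \<Union>F) \<noteq> {}}" if "F \<subseteq> Fl" for F
      proof
        show "F \<subseteq> {C \<in> Fl. C \<inter> (base \<union> \<Union>F) \<noteq> {}}"
        proof
          fix C assume C: "C \<in> F"
          hence "C \<noteq> {}" using that in_quotient_imp_non_empty[OF eqv] unfolding Fl_def by blast
          thus "C \<in> {C \<in> Fl. C \<inter> (base \<union> \<Union>F) \<noteq> {}}" using C that by blast
        qed
        show "{C \<in> Fl. C \<inter> (base \<union> \<Union>F) \<noteq> {}} \<subseteq> F"
        proof
          fix C assume "C \<in> {C \<in> Fl. C \<inter> (base \<union> \<Union>F) \<noteq> {}}"
          then obtain c where C: "C \<in> Fl" "c \<in> C" "c \<in> base \<union> \<Union>F" by blast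
          have "c \<notin> base"
          proof
            assume "c \<in> base"
            then obtain u where "u \<in> Out" "(u, c) \<in> ?R" unfolding base_def by blast
            hence "u \<in> C" using cls[of C c u] C symR unfolding Fl_def by blast
            thus False using C(1) \<open>u \<in> Out\<close> Out unfolding Fl_def by blast
          qed
          then obtain C' where C': "C' \<in> F" "c \<in> C'" using C by blast
          hence "C = C'" using quotient_disj[OF eqv, of C C'] C that unfolding Fl_def by blast
          thus "C \<in> F" using C' by simp
        qed
      qed
      show "M F = M G \<longleftrightarrow> F = G"
      proof
        assume "M F = M G"
        hence "base \<union> \<Union>F = base \<union> \<Union>G" using W_M[of F] W_M[of G] FG by auto
        thus "F = G" using recover[of F] recover[of G] FG by auto
      qed simp
    next
      fix F assume F: "F \<in> Pow Fl"
      have "?R `` base \<subseteq> base" unfolding base_def using transR by blast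
      moreover have "?R `` (\<Union>F) \<subseteq> \<Union>F" using F cls unfolding Fl_def by blast
      ultimately have "?R `` ?W (M F) \<subseteq> ?W (M F)" using W_M[of F] F by blast
      moreover have "M F \<subseteq> {1..n}"
        using base_V Fl_mid[of F] F by (auto simp: M_def product_verts_def)
      ultimately show "M F \<in> good" by (simp add: good_def)
    next
      fix Y assume "Y \<in> good"
      hence Y: "Y \<subseteq> {1..n}" "?R `` ?W Y \<subseteq> ?W Y" by (auto simp: good_def)
      define F where "F = {C \<in> Fl. C \<subseteq> ?W Y}"
      have F: "F \<subseteq> Fl" by (auto simp: F_def)
      have "Out \<subseteq> ?W Y" using Out by blast
      hence "base \<subseteq> ?W Y" using Y(2) unfolding base_def by blast
      hence "base \<union> \<Union>F \<subseteq> ?W Y" unfolding F_def by blast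
      hence 1: "M F \<subseteq> Y" by (auto simp: M_def product_set_def)
      have 2: "y \<in> M F" if y: "y \<in> Y" for y
      proof -
        let ?C = "?R `` {Middle y}"
        have My: "Middle y \<in> ?V" using y Y(1) by (auto simp: product_verts_def)
        have "Middle y \<in> ?W Y" using y by (simp add: product_set_def)
        hence C: "?C \<subseteq> ?W Y" using Y(2) by blast
        show ?thesis
        proof (cases "?C \<subseteq> range Middle")
          case True
          moreover have "u \<in> Middle ` Y" if "u \<in> ?W Y" "u \<in> range Middle" for u
            using that by (auto simp: product_set_def)
          ultimately have "?C \<subseteq> Middle ` {1..n}" using C Y(1) by blast
          hence "?C \<in> F" using C quotientI[OF My] unfolding F_def Fl_def by blast
          thus ?thesis using equiv_class_self[OF eqv My] unfolding M_def by blast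
        next
          case False
          then obtain u where "(Middle y, u) \<in> ?R" "u \<notin> range Middle" by blast
          moreover from this have "u \<in> Out" using C Out[of u Y] by blast
          ultimately have "Middle y \<in> base" unfolding base_def using symR by blast
          thus ?thesis by (simp add: M_def)
        qed
      qed
      have "Y = M F" using 1 2 by blast
      thus "\<exists>F\<in>Pow Fl. Y = M F" using F by blast
    qed
    have "finite Fl" unfolding Fl_def
      using finite_quotient[of ?V ?R] equiv_type[OF eqv] by simp
    hence "card good = 2 ^ card Fl" using bij_betw_same_card[OF bij] by (simp add: card_Pow)
    moreover have "card Fl = floating m n t a b"
      by (simp add: Fl_def floating_def product_components_def)
    ultimately show ?thesis using True good by simp
  qed
qed

lemma diagram_matrix_mult:
  assumes a: "pairing m n a" and b: "pairing n t b"
  shows "diagram_matrix m n a * diagram_matrix n t b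
    = (2 :: 'k::field) ^ floating m n t a b \<cdot>\<^sub>m diagram_matrix m t (diagram_product m n t a b)"
proof (rule eq_mat_subsetsI)
  fix X Z assume XZ: "X \<subseteq> {1..m}" "Z \<subseteq> {1..t}"
  have "(diagram_matrix m n a * diagram_matrix n t b :: 'k mat) $$ (subset_index m X, subset_index t Z)
    = (\<Sum>Y\<in>Pow {1..n}. of_bool (block_union a (vertex_set X Y) \<and> block_union b (vertex_set Y Z)))"
    unfolding mult_mat_subsets[OF diagram_matrix_carrier diagram_matrix_carrier XZ]
    by (intro sum.cong refl) (use XZ in \<open>simp add: diagram_matrix_entry\<close>)
  also have "\<dots> = of_nat (card {Y \<in> Pow {1..n}. block_union a (vertex_set X Y) \<and> block_union b (vertex_set Y Z)})"
    by (subst sum_of_bool_eq) (auto simp: Int_def)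
  also have "\<dots> = 2 ^ floating m n t a b * of_bool (block_union (diagram_product m n t a b) (vertex_set X Z))"
    unfolding card_middle_subsets[OF a b XZ] by simp
  also have "\<dots> = (2 ^ floating m n t a b \<cdot>\<^sub>m diagram_matrix m t (diagram_product m n t a b) :: 'k mat)
      $$ (subset_index m X, subset_index t Z)"
    using XZ subset_index_less[of X m] subset_index_less[of Z t]
    by (simp add: diagram_matrix_entry carrier_matD[OF diagram_matrix_carrier])
  finally show "(diagram_matrix m n a * diagram_matrix n t b :: 'k mat) $$ (subset_index m X, subset_index t Z)
    = (2 ^ floating m n t a b \<cdot>\<^sub>m diagram_matrix m t (diagram_product m n t a b) :: 'k mat)
      $$ (subset_index m X, subset_index t Z)" .
qed (use mult_carrier_mat[OF diagram_matrix_carrier diagram_matrix_carrier] in simp_all)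

section \<open>Linear independence\<close>

lemma boundary_pos_image: "boundary_pos ` verts m n = {- int m..<int n}"
proof
  show "{- int m..<int n} \<subseteq> boundary_pos ` verts m n"
  proof
    fix i assume i: "i \<in> {- int m..<int n}"
    show "i \<in> boundary_pos ` verts m n"
    proof (cases "i < 0")
      case True
      thus ?thesis using i by (intro image_eqI[of _ _ "Upper (nat (- i))"]) auto
    next
      case False
      thus ?thesis using i by (intro image_eqI[of _ _ "Lower (nat (i + 1))"]) auto
    qed
  qed
qed (auto simp: verts_def)

lemma inj_on_boundary_pos: "inj_on boundary_pos (verts m n)"
  by (rule inj_onI) (auto simp: verts_def)

lemma pairing_ends:
  assumes "pairing m n a" "{p, q} \<in> a"
  shows "p \<in> verts m n" "q \<in> verts m n" "p \<noteq> q" "boundary_pos p \<noteq> boundary_pos q"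
proof -
  show *: "p \<in> verts m n" "q \<in> verts m n" using assms pairingD(1) by blast+
  show "p \<noteq> q" using pairingD(3)[OF assms] by auto
  thus "boundary_pos p \<noteq> boundary_pos q" using inj_onD[OF inj_on_boundary_pos _ *] by blast
qed

lemma pairing_partner:
  assumes "pairing m n a" "v \<in> verts m n"
  obtains w where "{v, w} \<in> a"
proof -
  obtain B where B: "B \<in> a" "v \<in> B" using assms pairingD(1) by blast
  then obtain w where "B = {v, w}" using pairingD(3)[OF assms(1) B(1)] by (auto simp: card_2_iff)
  thus thesis using that B by blast
qed

lemma pairing_partner_unique:
  assumes "pairing m n a" "{p, q} \<in> a" "{p, r} \<in> a"
  shows "q = r"
proof -
  have "{p, q} = {p, r}" using pairing_block_eq[OF assms, of p] by simp
  thus ?thesis by (auto simp: doubleton_eq_iff)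
qed

text \<open>
  No block joins a vertex strictly between \<open>p\<close> and \<open>q\<close> to a vertex that is not, so the vertices
  in between are a union of blocks and their number is even.
\<close>

lemma noncrossing_opposite_parity:
  assumes a: "pairing m n a" "noncrossing a" and pq: "{p, q} \<in> a"
  shows "even (boundary_pos p) \<longleftrightarrow> odd (boundary_pos q)"
proof -
  have ordered: "even (boundary_pos p) \<longleftrightarrow> odd (boundary_pos q)"
    if pq: "{p, q} \<in> a" and less: "boundary_pos p < boundary_pos q" for p q
  proof -
    note ends = pairing_ends[OF a(1) pq]
    define I where "I = {v \<in> verts m n. boundary_pos p < boundary_pos v \<and> boundary_pos v < boundary_pos q}"
    have partner: "w \<in> I" if v: "v \<in> I" and vw: "{v, w} \<in> a" for v w
    proof -
      have w: "w \<in> verts m n" using pairing_ends[OF a(1) vw] by simp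
      have "w \<noteq> p"
      proof
        assume "w = p"
        hence "{p, v} \<in> a" using vw by (simp add: insert_commute)
        hence "v = q" using pairing_partner_unique[OF a(1) pq] by simp
        thus False using v by (simp add: I_def)
      qed
      moreover have "w \<noteq> q"
      proof
        assume "w = q"
        hence "{q, v} \<in> a" "{q, p} \<in> a" using vw pq by (simp_all add: insert_commute)
        hence "v = p" using pairing_partner_unique[OF a(1)] by blast
        thus False using v by (simp add: I_def)
      qed
      ultimately have "boundary_pos w \<noteq> boundary_pos p" "boundary_pos w \<noteq> boundary_pos q"
        using inj_onD[OF inj_on_boundary_pos _ w] ends by blast+
      moreover have "\<not> boundary_pos q < boundary_pos w"
        using a(2) pq vw v unfolding noncrossing_def I_def by blast
      moreover have "{w, v} \<in> a" using vw by (simp add: insert_commute)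
      hence "\<not> boundary_pos w < boundary_pos p"
        using a(2) pq v unfolding noncrossing_def I_def by blast
      ultimately show ?thesis using w by (simp add: I_def)
    qed
    have "v \<in> \<Union>{B \<in> a. B \<subseteq> I}" if v: "v \<in> I" for v
    proof -
      have "v \<in> verts m n" using v by (simp add: I_def)
      then obtain w where w: "{v, w} \<in> a" by (rule pairing_partner[OF a(1)])
      thus ?thesis using v partner[OF v w] by blast
    qed
    hence "I = \<Union>{B \<in> a. B \<subseteq> I}" by blast
    moreover have "card (\<Union>{B \<in> a. B \<subseteq> I}) = 2 * card {B \<in> a. B \<subseteq> I}"
      using pairingD[OF a(1)] by (intro card_Union_pairs) (auto simp: disjoint_def)
    ultimately have "even (card I)" by (metis dvd_triv_left)
    moreover have "card I = card {boundary_pos p<..<boundary_pos q}"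
    proof -
      have "boundary_pos p \<in> {- int m..<int n}" "boundary_pos q \<in> {- int m..<int n}"
        using ends boundary_pos_image[of m n] by blast+
      hence "boundary_pos ` I = {boundary_pos p<..<boundary_pos q}"
        using boundary_pos_image[of m n] unfolding I_def by (auto simp: image_iff set_eq_iff) (smt (verit) atLeastLessThan_iff image_iff)
      moreover have "inj_on boundary_pos I" by (rule inj_on_subset[OF inj_on_boundary_pos]) (auto simp: I_def)
      ultimately show ?thesis using card_image by metis
    qed
    ultimately have "even (nat (boundary_pos q - boundary_pos p - 1))" by (simp add: diff_diff_add)
    hence "even (boundary_pos q - boundary_pos p - 1)" using less by (simp add: even_nat_iff)
    thus ?thesis by presburger
  qed
  from pairing_ends[OF a(1) pq] consider "boundary_pos p < boundary_pos q" | "boundary_pos q < boundary_pos p"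
    by linarith
  thus ?thesis
  proof cases
    case 1 thus ?thesis by (rule ordered[OF pq])
  next
    case 2
    have "{q, p} \<in> a" using pq by (simp add: insert_commute)
    from ordered[OF this 2] show ?thesis by simp
  qed
qed

text \<open>
  Reading the boundary as a line turns each block into a pair of parentheses; these are the opening
  ones.
\<close>

definition openers :: "diagram \<Rightarrow> vertex set" where
  "openers a = {p. \<exists>q. {p, q} \<in> a \<and> boundary_pos p < boundary_pos q}"

lemma openers_Int_block:
  assumes "pairing m n a" "{p, q} \<in> a" "boundary_pos p < boundary_pos q"
  shows "{p, q} \<inter> openers a = {p}"
proof -
  have "q \<notin> openers a"
  proof
    assume "q \<in> openers a"
    then obtain r where r: "{q, r} \<in> a" "boundary_pos q < boundary_pos r" by (auto simp: openers_def)
    moreover have "{q, p} \<in> a" using assms(2) by (simp add: insert_commute)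
    ultimately have "r = p" using pairing_partner_unique[OF assms(1)] by blast
    thus False using r assms(3) by simp
  qed
  moreover have "p \<in> openers a" using assms by (auto simp: openers_def)
  ultimately show ?thesis by blast
qed

lemma pairing_block_ordered:
  assumes "pairing m n a" "B \<in> a"
  obtains p q where "B = {p, q}" "boundary_pos p < boundary_pos q"
proof -
  obtain p q where B: "B = {p, q}" using pairingD(3)[OF assms] by (auto simp: card_2_iff)
  have "boundary_pos p \<noteq> boundary_pos q" using pairing_ends(4)[OF assms(1)] assms(2) B by blast
  thus thesis using that[of p q] that[of q p] B by (cases "boundary_pos p < boundary_pos q") (auto simp: insert_commute)
qed

lemma openers_subset: "pairing m n a \<Longrightarrow> openers a \<subseteq> verts m n"
  using pairing_ends(1) by (auto simp: openers_def)

text \<open>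
  This is the inductive step in showing that the opening parentheses of a bracketing determine it:
  among the blocks on which \<open>a\<close> and \<open>b\<close> differ, a shortest one cannot exist. Let \<open>p\<close> be matched
  with \<open>q\<close> in \<open>a\<close> and with \<open>q'\<close> in \<open>b\<close>. If \<open>q'\<close> comes before \<open>q\<close>, the block of \<open>q'\<close> is a
  shorter such block. If it comes after \<open>q\<close>, then \<open>q\<close> closes in \<open>b\<close> a block inside that of \<open>p\<close>,
  and this one is shorter and does not occur in \<open>a\<close>.
\<close>

lemma openers_determine_block:
  assumes a: "pairing m n a" and b: "pairing m n b" "noncrossing b" and eq: "openers a = openers b"
    and pq: "{p, q} \<in> a" "boundary_pos p < boundary_pos q"
    and IH: "\<And>r s. boundary_pos r < boundary_pos s \<Longrightarrow>
      boundary_pos s - boundary_pos r < boundary_pos q - boundary_pos p \<Longrightarrow> {r, s} \<in> a \<longleftrightarrow> {r, s} \<in> b"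
  shows "{p, q} \<in> b"
proof -
  have "p \<in> openers b" using pq eq by (auto simp: openers_def)
  then obtain q' where q': "{p, q'} \<in> b" "boundary_pos p < boundary_pos q'" by (auto simp: openers_def)
  note va = pairing_ends[OF a pq(1)] and vb = pairing_ends[OF b(1) q'(1)]
  have qp: "{q, p} \<in> a" using pq(1) by (simp add: insert_commute)
  show ?thesis
  proof (rule ccontr)
    assume notb: "{p, q} \<notin> b"
    hence "q \<noteq> q'" using q' by blast
    hence "boundary_pos q \<noteq> boundary_pos q'" using inj_onD[OF inj_on_boundary_pos] va vb by blast
    moreover have "\<not> boundary_pos q' < boundary_pos q"
    proof
      assume "boundary_pos q' < boundary_pos q"
      hence "{p, q'} \<in> a" using IH[OF q'(2)] q'(1) by simp
      thus False using pairing_partner_unique[OF a pq(1)] \<open>q \<noteq> q'\<close> by blast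
    qed
    ultimately have less: "boundary_pos q < boundary_pos q'" by simp
    \<comment> \<open>In \<open>b\<close>, the vertex \<open>q\<close> lies inside the block of \<open>p\<close>; its partner is trapped there, and
      lies before \<open>q\<close> because \<open>q\<close> is not an opener of \<open>a\<close>.\<close>
    obtain r where r: "{q, r} \<in> b" using pairing_partner[OF b(1) va(2)] by blast
    have rq: "{r, q} \<in> b" using r by (simp add: insert_commute)
    have "\<not> boundary_pos q < boundary_pos r"
    proof
      assume "boundary_pos q < boundary_pos r"
      hence "q \<in> openers a" using r eq by (auto simp: openers_def)
      hence "q \<in> {p, q} \<inter> openers a" by simp
      thus False using openers_Int_block[OF a pq] va(3) by simp
    qed
    hence rq_less: "boundary_pos r < boundary_pos q" using pairing_ends(4)[OF b(1) r] by simp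
    have "r \<noteq> p" using rq notb by blast
    hence "boundary_pos r \<noteq> boundary_pos p"
      using inj_onD[OF inj_on_boundary_pos] pairing_ends(2)[OF b(1) r] va by blast
    moreover have "\<not> boundary_pos r < boundary_pos p"
      using b(2) rq q'(1) pq(2) less unfolding noncrossing_def by blast
    ultimately have "{r, q} \<in> a" using IH[OF rq_less] rq by simp
    hence "{q, r} \<in> a" by (simp add: insert_commute)
    thus False using pairing_partner_unique[OF a qp] \<open>r \<noteq> p\<close> by blast
  qed
qed

lemma openers_inject:
  assumes a: "pairing m n a" "noncrossing a" and b: "pairing m n b" "noncrossing b"
    and eq: "openers a = openers b"
  shows "a = b"
proof -
  have "boundary_pos p < boundary_pos q \<Longrightarrow> nat (boundary_pos q - boundary_pos p) = k \<Longrightarrow>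
      {p, q} \<in> a \<longleftrightarrow> {p, q} \<in> b" for k p q
  proof (induction k arbitrary: p q rule: less_induct)
    case (less k)
    have IH: "{r, s} \<in> a \<longleftrightarrow> {r, s} \<in> b"
      if "boundary_pos r < boundary_pos s" "boundary_pos s - boundary_pos r < boundary_pos q - boundary_pos p" for r s
      using less.IH[of "nat (boundary_pos s - boundary_pos r)" r s] less.prems that by simp
    show ?case
      using openers_determine_block[OF a(1) b eq _ less.prems(1) IH]
        openers_determine_block[OF b(1) a eq[symmetric] _ less.prems(1) IH[symmetric]] by blast
  qed
  hence "B \<in> a \<longleftrightarrow> B \<in> b" for B
    using pairing_block_ordered[OF a(1), of B] pairing_block_ordered[OF b(1), of B] by metis
  thus ?thesis by blast
qed

definition opener_weight :: "diagram \<Rightarrow> int" where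
  "opener_weight a = (\<Sum>v\<in>openers a. boundary_pos v)"

lemma sum_over_blocks:
  assumes "pairing m n a" "T \<subseteq> verts m n"
  shows "(\<Sum>v\<in>T. boundary_pos v) = (\<Sum>B\<in>a. \<Sum>v\<in>B \<inter> T. boundary_pos v)"
proof -
  have fin: "finite a" using pairingD(1)[OF assms(1)] finite_verts by (metis finite_UnionD)
  have finB: "finite B" if "B \<in> a" for B using pairingD(3)[OF assms(1) that] by (simp add: card_ge_0_finite)
  have "T = (\<Union>B\<in>a. B \<inter> T)" using assms(2) pairingD(1)[OF assms(1)] by blast
  moreover have "(\<Sum>v\<in>(\<Union>B\<in>a. B \<inter> T). boundary_pos v) = (\<Sum>B\<in>a. \<Sum>v\<in>B \<inter> T. boundary_pos v)"
    using fin finB disjointD[OF pairingD(2)[OF assms(1)]]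
    by (intro sum.UNION_disjoint) blast+
  ultimately show ?thesis by simp
qed

text \<open>
  A transversal contains the left or the right end of each block. Choosing left ends throughout
  gives the least sum of positions, and every other choice a larger one.
\<close>

lemma transversal_weight:
  assumes a: "pairing m n a" and T: "T \<subseteq> verts m n" "\<And>B. B \<in> a \<Longrightarrow> card (B \<inter> T) = 1"
  shows "opener_weight a \<le> (\<Sum>v\<in>T. boundary_pos v)"
    and "opener_weight a = (\<Sum>v\<in>T. boundary_pos v) \<Longrightarrow> T = openers a"
proof -
  let ?w = "\<lambda>S B. \<Sum>v\<in>B \<inter> S. boundary_pos v"
  have fin: "finite a" using pairingD(1)[OF a] finite_verts by (metis finite_UnionD)
  have block: "?w (openers a) B \<le> ?w T B \<and> (?w (openers a) B = ?w T B \<longrightarrow> B \<inter> T = B \<inter> openers a)"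
    if B: "B \<in> a" for B
  proof -
    obtain p q where pq: "B = {p, q}" "boundary_pos p < boundary_pos q"
      using pairing_block_ordered[OF a B] .
    have open_eq: "B \<inter> openers a = {p}" using openers_Int_block[OF a _ pq(2)] B by (simp add: pq(1))
    obtain v where v: "B \<inter> T = {v}" using T(2)[OF B] by (auto simp: card_1_singleton_iff)
    hence "v = p \<or> v = q" using pq(1) by blast
    thus ?thesis using open_eq v pq(2) by auto
  qed
  have sums: "opener_weight a = sum (?w (openers a)) a" "(\<Sum>v\<in>T. boundary_pos v) = sum (?w T) a"
    unfolding opener_weight_def
    by (rule sum_over_blocks[OF a]; use openers_subset[OF a] T in blast)+
  show "opener_weight a \<le> (\<Sum>v\<in>T. boundary_pos v)"
    unfolding sums using block by (intro sum_mono) blast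
  assume "opener_weight a = (\<Sum>v\<in>T. boundary_pos v)"
  hence "sum (?w (openers a)) a = sum (?w T) a" unfolding sums .
  hence "?w (openers a) B = ?w T B" if "B \<in> a" for B
    using sum_mono_inv[of "?w (openers a)" a "?w T" B] block that fin by blast
  hence "B \<inter> T = B \<inter> openers a" if "B \<in> a" for B using block that by blast
  hence "\<Union>a \<inter> T = \<Union>a \<inter> openers a" by blast
  thus "T = openers a" using T(1) openers_subset[OF a] pairingD(1)[OF a] by blast
qed

text \<open>
  \<open>T\<close>, complemented at the even positions.
\<close>

definition twist :: "nat \<Rightarrow> nat \<Rightarrow> vertex set \<Rightarrow> vertex set" where
  "twist m n T = {v \<in> verts m n. v \<in> T \<longleftrightarrow> odd (boundary_pos v)}"

text \<open>
  One end of a block has an even and the other an odd position, so exactly one of them is complemented.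
\<close>

lemma block_union_twist:
  assumes a: "pairing m n a" "noncrossing a"
  shows "block_union a (twist m n T) \<longleftrightarrow> (\<forall>B\<in>a. card (B \<inter> T) = 1)"
proof -
  have block: "B \<subseteq> twist m n T \<or> B \<inter> twist m n T = {} \<longleftrightarrow> card (B \<inter> T) = 1" if B: "B \<in> a" for B
  proof -
    obtain p q where pq: "B = {p, q}" "boundary_pos p < boundary_pos q" using pairing_block_ordered[OF a(1) B] .
    have "{p, q} \<in> a" using B pq by simp
    note ends = pairing_ends[OF a(1) this] and par = noncrossing_opposite_parity[OF a this]
    have "card (B \<inter> T) = 1 \<longleftrightarrow> (p \<in> T \<longleftrightarrow> q \<notin> T)"
      using ends(3) by (cases "p \<in> T"; cases "q \<in> T") (simp_all add: pq(1))
    also have "\<dots> \<longleftrightarrow> (p \<in> twist m n T \<longleftrightarrow> q \<in> twist m n T)"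
      using ends(1,2) par by (auto simp: twist_def)
    also have "\<dots> \<longleftrightarrow> B \<subseteq> twist m n T \<or> B \<inter> twist m n T = {}" by (auto simp: pq(1))
    finally show ?thesis by simp
  qed
  have blocks: "(\<forall>B\<in>a. B \<subseteq> twist m n T \<or> B \<inter> twist m n T = {}) \<longleftrightarrow> (\<forall>B\<in>a. card (B \<inter> T) = 1)"
    by (rule ball_cong[OF refl block])
  have "twist m n T \<subseteq> \<Union>a" using pairingD(1)[OF a(1)] by (auto simp: twist_def)
  thus ?thesis unfolding block_union_iff[OF pairingD(2)[OF a(1)]] blocks by simp
qed

text \<open>
  The matrix of the values of these indicators at the sets \<open>twist m n (openers a)\<close> is unitriangular
  with respect to \<open>opener_weight\<close>.
\<close>

lemma block_union_indicators_independent: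
  fixes c :: "diagram \<Rightarrow> 'k::field"
  assumes fin: "finite A" and A: "\<And>a. a \<in> A \<Longrightarrow> pairing m n a" "\<And>a. a \<in> A \<Longrightarrow> noncrossing a"
    and nz: "\<And>a. a \<in> A \<Longrightarrow> c a \<noteq> 0"
    and zero: "\<And>S. S \<subseteq> verts m n \<Longrightarrow> (\<Sum>a\<in>A. c a * of_bool (block_union a S)) = 0"
  shows "A = {}"
proof (rule ccontr)
  assume "A \<noteq> {}"
  have "Min (opener_weight ` A) \<in> opener_weight ` A" using fin \<open>A \<noteq> {}\<close> by simp
  then obtain a where "a \<in> A" and "opener_weight a = Min (opener_weight ` A)" by (metis imageE)
  hence a: "a \<in> A" "\<And>b. b \<in> A \<Longrightarrow> opener_weight a \<le> opener_weight b" using fin by simp_all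
  note pa = A(1)[OF a(1)]
  define S where "S = twist m n (openers a)"
  have "c b * of_bool (block_union b S) = (if b = a then c a else 0)" if b: "b \<in> A" for b
  proof (cases "b = a")
    case True
    have "card (B \<inter> openers a) = 1" if "B \<in> a" for B
    proof -
      obtain p q where pq: "B = {p, q}" "boundary_pos p < boundary_pos q"
        using pairing_block_ordered[OF pa \<open>B \<in> a\<close>] .
      show ?thesis using openers_Int_block[OF pa _ pq(2)] that by (simp add: pq(1))
    qed
    hence "block_union a S" unfolding S_def block_union_twist[OF pa A(2)[OF a(1)]] by blast
    thus ?thesis using True by simp
  next
    case False
    have "\<not> block_union b S"
    proof
      assume "block_union b S"
      hence tr: "card (B \<inter> openers a) = 1" if "B \<in> b" for B
        using that unfolding S_def block_union_twist[OF A(1)[OF b] A(2)[OF b]] by blast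
      note w = transversal_weight[OF A(1)[OF b] openers_subset[OF pa] tr]
      have "opener_weight b = (\<Sum>v\<in>openers a. boundary_pos v)"
        using w(1) a(2)[OF b] opener_weight_def[of a] by linarith
      hence "openers a = openers b" using w(2) by blast
      thus False using openers_inject[OF pa A(2)[OF a(1)] A(1)[OF b] A(2)[OF b]] False by simp
    qed
    thus ?thesis using False by simp
  qed
  hence "(\<Sum>b\<in>A. c b * of_bool (block_union b S)) = (\<Sum>b\<in>A. if b = a then c a else 0)"
    by (rule sum.cong[OF refl])
  also have "\<dots> = c a" using fin a(1) by simp
  finally have "c a = 0" using zero[of S] by (simp add: S_def twist_def)
  thus False using nz a(1) by simp
qed

section \<open>The representation\<close>

lemma TL_D:
  assumes "a \<in> TL m n"
  shows "pairing m n a" "noncrossing a"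
  using assms planar_imp_noncrossing[of a m n] pairingD(1)[of m n a] by (auto simp: TL_iff)

lemma diagram_product_in_TL:
  "a \<in> TL m n \<Longrightarrow> b \<in> TL n t \<Longrightarrow> diagram_product m n t a b \<in> TL m t"
  by (simp add: TL_iff pairing_diagram_product planar_diagram_product)

lemma diagram_id_in_TL: "diagram_id n \<in> TL n n"
proof -
  have "\<Union>(diagram_id n) = verts n n" by (auto simp: diagram_id_def verts_def)
  moreover have "disjoint (diagram_id n)" by (auto simp: diagram_id_def disjoint_def)
  ultimately have "pairing n n (diagram_id n)"
    by (auto simp: pairing_def partition_on_def diagram_id_def)
  thus ?thesis by (simp add: TL_iff planar_diagram_id)
qed

definition linear_extension :: "('a \<Rightarrow>\<^sub>0 'k::field) \<Rightarrow> ('a \<Rightarrow> 'k) \<Rightarrow> 'k" where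
  "linear_extension f g = (\<Sum>a\<in>Poly_Mapping.keys f. Poly_Mapping.lookup f a * g a)"

lemma linear_extension_superset:
  assumes "finite S" "Poly_Mapping.keys f \<subseteq> S"
  shows "linear_extension f g = (\<Sum>a\<in>S. Poly_Mapping.lookup f a * g a)"
  unfolding linear_extension_def
  by (rule sum.mono_neutral_left) (use assms in \<open>auto simp: in_keys_iff\<close>)

lemma linear_extension_0 [simp]: "linear_extension 0 g = 0"
  by (simp add: linear_extension_def)

lemma linear_extension_single [simp]: "linear_extension (Poly_Mapping.single a c) g = c * g a"
  by (subst linear_extension_superset[of "{a}"]) auto

lemma linear_extension_add: "linear_extension (f + h) g = linear_extension f g + linear_extension h g"
proof -
  let ?S = "Poly_Mapping.keys f \<union> Poly_Mapping.keys h"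
  have "linear_extension (f + h) g = (\<Sum>a\<in>?S. Poly_Mapping.lookup (f + h) a * g a)"
    by (rule linear_extension_superset) (auto simp: Poly_Mapping.keys_add)
  moreover have "linear_extension f g = (\<Sum>a\<in>?S. Poly_Mapping.lookup f a * g a)"
    "linear_extension h g = (\<Sum>a\<in>?S. Poly_Mapping.lookup h a * g a)"
    by (rule linear_extension_superset; simp)+
  ultimately show ?thesis by (simp add: lookup_add ring_distribs sum.distrib)
qed

lemma linear_extension_sum: "linear_extension (\<Sum>i\<in>I. f i) g = (\<Sum>i\<in>I. linear_extension (f i) g)"
  by (induction I rule: infinite_finite_induct) (simp_all add: linear_extension_add)

lemma linear_extension_scale:
  "linear_extension (Poly_Mapping.map ((*) c) f) g = c * linear_extension f g"
proof -
  have "Poly_Mapping.keys (Poly_Mapping.map ((*) c) f) \<subseteq> Poly_Mapping.keys f"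
    by (auto simp: in_keys_iff map.rep_eq)
  hence "linear_extension (Poly_Mapping.map ((*) c) f) g
      = (\<Sum>a\<in>Poly_Mapping.keys f. Poly_Mapping.lookup (Poly_Mapping.map ((*) c) f) a * g a)"
    by (intro linear_extension_superset) auto
  also have "\<dots> = c * linear_extension f g"
    unfolding linear_extension_def sum_distrib_left
    by (intro sum.cong refl) (simp add: map.rep_eq when_def mult.assoc)
  finally show ?thesis .
qed

lemma linear_extension_mult:
  "linear_extension f g * linear_extension f' g'
    = (\<Sum>a\<in>Poly_Mapping.keys f. \<Sum>b\<in>Poly_Mapping.keys f'.
        Poly_Mapping.lookup f a * Poly_Mapping.lookup f' b * (g a * g' b))"
  by (simp add: linear_extension_def sum_product mult_ac)

lemma TL_rep_carrier [simp]: "TL_rep m n f \<in> carrier_mat (2 ^ m) (2 ^ n)"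
  by (simp add: TL_rep_def)

lemma TL_rep_entry:
  assumes "X \<subseteq> {1..m}" "Y \<subseteq> {1..n}"
  shows "TL_rep m n f $$ (subset_index m X, subset_index n Y)
    = linear_extension f (\<lambda>a. of_bool (block_union a (vertex_set X Y)))"
  using assms
  by (simp add: TL_rep_def subset_index_less diagram_matrix_entry linear_extension_def)

lemma TL_rep_single: "TL_rep m n (Poly_Mapping.single a 1) = diagram_matrix m n a"
  by (rule eq_mat_subsetsI[of _ m n]) (simp_all add: TL_rep_entry diagram_matrix_entry)

text \<open>
  The difference of \<open>f\<close> and \<open>g\<close> is a vanishing combination of the indicators in
  \<open>block_union_indicators_independent\<close>, since every vertex set has the form \<open>X \<union> Y'\<close> and so
  belongs to a matrix entry.
\<close>

lemma TL_rep_inj: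
  assumes f: "Poly_Mapping.keys f \<subseteq> TL m n" and g: "Poly_Mapping.keys g \<subseteq> TL m n"
    and eq: "TL_rep m n f = (TL_rep m n g :: 'k::field mat)"
  shows "f = g"
proof -
  define h where "h = f - g"
  have keys: "Poly_Mapping.keys h \<subseteq> TL m n"
  proof
    fix a assume "a \<in> Poly_Mapping.keys h"
    hence "Poly_Mapping.lookup f a - Poly_Mapping.lookup g a \<noteq> 0" by (simp add: h_def in_keys_iff lookup_minus)
    hence "Poly_Mapping.lookup f a \<noteq> 0 \<or> Poly_Mapping.lookup g a \<noteq> 0" by auto
    hence "a \<in> Poly_Mapping.keys f \<or> a \<in> Poly_Mapping.keys g" by (simp only: in_keys_iff)
    thus "a \<in> TL m n" using f g by blast
  qed
  have zero: "(\<Sum>a\<in>Poly_Mapping.keys h. Poly_Mapping.lookup h a * of_bool (block_union a S)) = 0"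
    if S: "S \<subseteq> verts m n" for S
  proof -
    let ?X = "{x. Upper x \<in> S}" and ?Y = "{y. Lower y \<in> S}"
    have XY: "?X \<subseteq> {1..m}" "?Y \<subseteq> {1..n}" using S by auto
    have S: "S = vertex_set ?X ?Y"
      by (rule Set.set_eqI) (case_tac x; simp)
    let ?i = "\<lambda>a. of_bool (block_union a S) :: 'k"
    have "linear_extension f ?i = linear_extension g ?i"
      using TL_rep_entry[OF XY, of f] TL_rep_entry[OF XY, of g] eq S by simp
    moreover have "linear_extension (h + g) ?i = linear_extension h ?i + linear_extension g ?i"
      by (rule linear_extension_add)
    ultimately have "linear_extension h ?i = 0" by (simp add: h_def)
    thus ?thesis by (simp add: linear_extension_def)
  qed
  have "Poly_Mapping.keys h = {}"
    by (rule block_union_indicators_independent[OF _ _ _ _ zero])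
      (use keys TL_D in \<open>auto simp: in_keys_iff\<close>)
  thus ?thesis by (simp add: h_def)
qed

lemma TL_rep_comp:
  fixes f g :: "'k::field combination"
  assumes f: "Poly_Mapping.keys f \<subseteq> TL m n" and g: "Poly_Mapping.keys g \<subseteq> TL n t"
  shows "TL_rep m t (TL_comp 2 m n t f g) = TL_rep m n f * TL_rep n t g"
proof (rule eq_mat_subsetsI)
  show "TL_rep m n f * TL_rep n t g \<in> carrier_mat (2 ^ m) (2 ^ t)"
    by (rule mult_carrier_mat[OF TL_rep_carrier TL_rep_carrier])
  fix X Z assume XZ: "X \<subseteq> {1..m}" "Z \<subseteq> {1..t}"
  let ?l = "Poly_Mapping.lookup" and ?k = "Poly_Mapping.keys"
  let ?A = "\<lambda>a X Y. of_bool (block_union a (vertex_set X Y)) :: 'k"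
  have product: "(\<Sum>Y\<in>Pow {1..n}. ?A a X Y * ?A b Y Z)
      = 2 ^ floating m n t a b * ?A (diagram_product m n t a b) X Z" if "a \<in> ?k f" "b \<in> ?k g" for a b
  proof -
    have "pairing m n a" "pairing n t b" using that f g TL_D(1) by blast+
    note D = diagram_matrix_mult[OF this, where 'k = 'k]
    have "(\<Sum>Y\<in>Pow {1..n}. ?A a X Y * ?A b Y Z)
        = (diagram_matrix m n a * diagram_matrix n t b) $$ (subset_index m X, subset_index t Z)"
      unfolding mult_mat_subsets[OF diagram_matrix_carrier diagram_matrix_carrier XZ]
      by (intro sum.cong refl) (use XZ in \<open>simp add: diagram_matrix_entry\<close>)
    thus ?thesis unfolding D
      using XZ subset_index_less[of X m] subset_index_less[of Z t]
      by (simp add: diagram_matrix_entry carrier_matD[OF diagram_matrix_carrier])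
  qed
  have "(TL_rep m n f * TL_rep n t g) $$ (subset_index m X, subset_index t Z)
    = (\<Sum>Y\<in>Pow {1..n}. linear_extension f (\<lambda>a. ?A a X Y) * linear_extension g (\<lambda>b. ?A b Y Z))"
    unfolding mult_mat_subsets[OF TL_rep_carrier TL_rep_carrier XZ]
    by (intro sum.cong refl) (use XZ in \<open>simp add: TL_rep_entry\<close>)
  also have "\<dots> = (\<Sum>a\<in>?k f. \<Sum>b\<in>?k g. \<Sum>Y\<in>Pow {1..n}. ?l f a * ?l g b * (?A a X Y * ?A b Y Z))"
    unfolding linear_extension_mult
    by (subst sum.swap, intro sum.cong refl, subst sum.swap, rule refl)
  also have "\<dots> = (\<Sum>a\<in>?k f. \<Sum>b\<in>?k g. ?l f a * ?l g b * (2 ^ floating m n t a b * ?A (diagram_product m n t a b) X Z))"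
    unfolding sum_distrib_left[symmetric] by (intro sum.cong refl) (simp only: product)
  also have "\<dots> = TL_rep m t (TL_comp 2 m n t f g) $$ (subset_index m X, subset_index t Z)"
    unfolding TL_rep_entry[OF XZ] TL_comp_def linear_extension_sum
    by (simp add: mult.assoc)
  finally show "TL_rep m t (TL_comp 2 m n t f g) $$ (subset_index m X, subset_index t Z)
    = (TL_rep m n f * TL_rep n t g) $$ (subset_index m X, subset_index t Z)" by (rule sym)
qed simp

lemma keys_TL_comp:
  assumes "Poly_Mapping.keys f \<subseteq> TL m n" "Poly_Mapping.keys g \<subseteq> TL n t"
  shows "Poly_Mapping.keys (TL_comp \<delta> m n t f g) \<subseteq> TL m t"
proof -
  have "Poly_Mapping.keys (Poly_Mapping.single (diagram_product m n t a b) c) \<subseteq> TL m t"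
    if "a \<in> Poly_Mapping.keys f" "b \<in> Poly_Mapping.keys g" for a b and c :: 'a
    using that assms diagram_product_in_TL[of a m n b t] by auto
  note key = this
  show ?thesis
    unfolding TL_comp_def by (intro subset_trans[OF keys_sum] UN_least key)
qed

lemma TL_rep_id: "TL_rep n n (Poly_Mapping.single (diagram_id n) 1) = (1\<^sub>m (2 ^ n) :: 'k::field mat)"
  unfolding TL_rep_single
proof (rule eq_mat_subsetsI)
  fix X Y assume XY: "X \<subseteq> {1..n}" "Y \<subseteq> {1..n}"
  note p = TL_D(1)[OF diagram_id_in_TL, of n]
  have "block_union (diagram_id n) (vertex_set X Y) \<longleftrightarrow> (\<forall>i\<in>{1..n}. i \<in> X \<longleftrightarrow> i \<in> Y)"
    unfolding block_union_iff[OF pairingD(2)[OF p]] pairingD(1)[OF p]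
    using vertex_set_subset[OF XY] by (auto simp: diagram_id_def)
  also have "\<dots> \<longleftrightarrow> X = Y" using XY by blast
  also have "\<dots> \<longleftrightarrow> subset_index n X = subset_index n Y"
    using XY subset_at_index by metis
  finally show "diagram_matrix n n (diagram_id n) $$ (subset_index n X, subset_index n Y)
      = (1\<^sub>m (2 ^ n) :: 'k mat) $$ (subset_index n X, subset_index n Y)"
    using XY by (simp add: diagram_matrix_entry subset_index_less)
qed simp_all

text \<open>
  Both sides of a law have the same matrix, as matrices satisfy it, and \<open>TL_rep_inj\<close> applies.
\<close>

lemma is_category_TL: "is_category (TL_cat (2 :: 'k::field))"
proof -
  let ?id = "\<lambda>n. Poly_Mapping.single (diagram_id n) (1 :: 'k)"
  have id: "Poly_Mapping.keys (?id n) \<subseteq> TL n n" for n using diagram_id_in_TL by simp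
  have left: "TL_comp 2 m m n (?id m) f = f" if f: "Poly_Mapping.keys f \<subseteq> TL m n" for m n f
    by (rule TL_rep_inj[OF keys_TL_comp[OF id f] f])
      (simp add: TL_rep_comp[OF id f] TL_rep_id left_mult_one_mat[OF TL_rep_carrier])
  have right: "TL_comp 2 m n n f (?id n) = f" if f: "Poly_Mapping.keys f \<subseteq> TL m n" for m n f
    by (rule TL_rep_inj[OF keys_TL_comp[OF f id] f])
      (simp add: TL_rep_comp[OF f id] TL_rep_id right_mult_one_mat[OF TL_rep_carrier])
  have assoc: "TL_comp 2 k m n (TL_comp 2 k l m f g) h = TL_comp 2 k l n f (TL_comp 2 l m n g h)"
    if f: "Poly_Mapping.keys f \<subseteq> TL k l" and g: "Poly_Mapping.keys g \<subseteq> TL l m"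
      and h: "Poly_Mapping.keys h \<subseteq> TL m n" for k l m n and f g h :: "'k combination"
  proof -
    note fg = keys_TL_comp[OF f g, of 2] and gh = keys_TL_comp[OF g h, of 2]
    show ?thesis
      by (rule TL_rep_inj[OF keys_TL_comp[OF fg h] keys_TL_comp[OF f gh]])
        (simp add: TL_rep_comp[OF fg h] TL_rep_comp[OF f gh] TL_rep_comp[OF f g] TL_rep_comp[OF g h]
          assoc_mult_mat[OF TL_rep_carrier TL_rep_carrier TL_rep_carrier])
  qed
  show ?thesis
    unfolding is_category_def TL_cat_def
    by (intro conjI allI ballI; simp add: diagram_id_in_TL keys_TL_comp left right assoc)
qed

lemma is_category_mat: "is_category (mat_cat :: (nat, 'k::field mat, 'k) linear_cat)"
  unfolding is_category_def mat_cat_def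
  by (auto intro!: mult_carrier_mat assoc_mult_mat)

lemma block_union_image:
  assumes "inj f"
  shows "block_union ((\<lambda>B. f ` B) ` a) (f ` S) \<longleftrightarrow> block_union a S"
proof
  assume "block_union ((\<lambda>B. f ` B) ` a) (f ` S)"
  then obtain T where T: "T \<subseteq> (\<lambda>B. f ` B) ` a" "\<Union>T = f ` S" by (elim exE conjE) (rule that)
  from T(1) obtain T' where T': "T' \<subseteq> a" "T = (\<lambda>B. f ` B) ` T'" by (rule subset_imageE)
  have "f ` \<Union>T' = f ` S" using T(2) T'(2) by (simp add: image_Union)
  hence "\<Union>T' = S" using assms by (simp add: inj_image_eq_iff)
  thus "block_union a S" using T' by blast
next
  assume "block_union a S"
  then obtain T where T: "T \<subseteq> a" "\<Union>T = S" by blast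
  thus "block_union ((\<lambda>B. f ` B) ` a) (f ` S)"
    by (intro exI[of _ "(\<lambda>B. f ` B) ` T"]) (auto simp: image_Union)
qed

lemma block_union_star:
  "block_union (diagram_star a) (vertex_set Y X) \<longleftrightarrow> block_union a (vertex_set X Y)"
proof -
  have "inj flip_vertex" by (rule injI, case_tac x; case_tac y; simp)
  moreover have "vertex_set Y X = flip_vertex ` vertex_set X Y"
    by (auto simp: vertex_set_def image_Un image_image)
  ultimately show ?thesis unfolding diagram_star_def by (simp only: block_union_image)
qed

lemma TL_rep_star: "TL_rep n m (TL_star f) = transpose_mat (TL_rep m n f)"
proof (rule eq_mat_subsetsI)
  fix Y X assume YX: "Y \<subseteq> {1..n}" "X \<subseteq> {1..m}"
  have "transpose_mat (TL_rep m n f) $$ (subset_index n Y, subset_index m X)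
      = TL_rep m n f $$ (subset_index m X, subset_index n Y)"
    using YX subset_index_less[of X m] subset_index_less[of Y n]
    by (simp add: carrier_matD[OF TL_rep_carrier])
  also have "\<dots> = TL_rep n m (TL_star f) $$ (subset_index n Y, subset_index m X)"
    unfolding TL_rep_entry[OF YX] TL_rep_entry[OF YX(2,1)] TL_star_def linear_extension_sum
      linear_extension_def[of f]
    by (simp add: block_union_star)
  finally show "TL_rep n m (TL_star f) $$ (subset_index n Y, subset_index m X)
    = transpose_mat (TL_rep m n f) $$ (subset_index n Y, subset_index m X)" by (rule sym)
qed simp_all

definition append_set :: "nat \<Rightarrow> nat set \<Rightarrow> nat set \<Rightarrow> nat set" where
  "append_set m X U = X \<union> (\<lambda>u. u + m) ` U"

lemma append_set_cases:
  assumes "P \<subseteq> {1..m + s}"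
  obtains X U where "X \<subseteq> {1..m}" "U \<subseteq> {1..s}" "P = append_set m X U"
proof
  show "P \<inter> {1..m} \<subseteq> {1..m}" "{u \<in> {1..s}. u + m \<in> P} \<subseteq> {1..s}" by auto
  show "P = append_set m (P \<inter> {1..m}) {u \<in> {1..s}. u + m \<in> P}"
  proof
    show "P \<subseteq> append_set m (P \<inter> {1..m}) {u \<in> {1..s}. u + m \<in> P}"
    proof
      fix x assume x: "x \<in> P"
      show "x \<in> append_set m (P \<inter> {1..m}) {u \<in> {1..s}. u + m \<in> P}"
      proof (cases "x \<le> m")
        case True thus ?thesis using x assms by (auto simp: append_set_def)
      next
        case False
        hence "x = (x - m) + m" "x - m \<in> {u \<in> {1..s}. u + m \<in> P}" using x assms by auto
        thus ?thesis unfolding append_set_def by blast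
      qed
    qed
  qed (auto simp: append_set_def)
qed

text \<open>
  The elements of \<open>X\<close> supply the higher and those of \<open>U\<close> the lower binary digits. This is why the
  Kronecker product, which splits an index by division with remainder, matches the tensor
  product of diagrams.
\<close>

lemma subset_index_append:
  assumes X: "X \<subseteq> {1..m}" and U: "U \<subseteq> {1..s}"
  shows "subset_index (m + s) (append_set m X U) = subset_index m X * 2 ^ s + subset_index s U"
proof -
  have fin: "finite X" "finite U" using X U by (auto intro: finite_subset)
  have "x \<noteq> u + m" if "x \<in> X" "u \<in> U" for x u
    using subsetD[OF X that(1)] subsetD[OF U that(2)] by simp
  hence "X \<inter> (\<lambda>u. u + m) ` U = {}" by blast
  hence "subset_index (m + s) (append_set m X U)
      = (\<Sum>x\<in>X. 2 ^ (m + s - x)) + (\<Sum>x\<in>(\<lambda>u. u + m) ` U. 2 ^ (m + s - x))"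
    unfolding subset_index_def append_set_def using fin by (intro sum.union_disjoint) auto
  moreover have "(\<Sum>x\<in>X. 2 ^ (m + s - x)) = subset_index m X * 2 ^ s"
    unfolding subset_index_def sum_distrib_right
  proof (rule sum.cong[OF refl])
    fix x assume "x \<in> X"
    hence "m + s - x = (m - x) + s" using X by auto
    thus "(2 :: nat) ^ (m + s - x) = 2 ^ (m - x) * 2 ^ s" by (simp add: power_add)
  qed
  moreover have "(\<Sum>x\<in>(\<lambda>u. u + m) ` U. 2 ^ (m + s - x)) = subset_index s U"
    by (subst sum.reindex) (auto simp: subset_index_def inj_on_def)
  ultimately show ?thesis by simp
qed

lemma block_union_Un:
  assumes disj: "\<Union>a \<inter> \<Union>b = {}" and S: "S \<subseteq> \<Union>a" "S' \<subseteq> \<Union>b"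
  shows "block_union (a \<union> b) (S \<union> S') \<longleftrightarrow> block_union a S \<and> block_union b S'"
proof
  assume "block_union (a \<union> b) (S \<union> S')"
  then obtain T where T: "T \<subseteq> a \<union> b" "\<Union>T = S \<union> S'" by (elim exE conjE) (rule that)
  have "T = (T \<inter> a) \<union> (T \<inter> b)" using T(1) by blast
  hence "\<Union>(T \<inter> a) \<union> \<Union>(T \<inter> b) = S \<union> S'" using T(2) by (metis Union_Un_distrib)
  moreover have "\<Union>(T \<inter> a) \<subseteq> \<Union>a" "\<Union>(T \<inter> b) \<subseteq> \<Union>b" by blast+
  ultimately have "\<Union>(T \<inter> a) = S" "\<Union>(T \<inter> b) = S'" using S disj by blast+
  thus "block_union a S \<and> block_union b S'"
    by (intro conjI exI[of _ "T \<inter> a"] exI[of _ "T \<inter> b"]) simp_all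
next
  assume "block_union a S \<and> block_union b S'"
  then obtain T T' where "T \<subseteq> a" "\<Union>T = S" "T' \<subseteq> b" "\<Union>T' = S'" by (elim exE conjE) (rule that)
  thus "block_union (a \<union> b) (S \<union> S')" by (intro exI[of _ "T \<union> T'"]) auto
qed

lemma block_union_tensor:
  assumes a: "pairing m n a" and b: "pairing s t b"
    and XY: "X \<subseteq> {1..m}" "Y \<subseteq> {1..n}" and UV: "U \<subseteq> {1..s}" "V \<subseteq> {1..t}"
  shows "block_union (diagram_tensor m n a b) (vertex_set (append_set m X U) (append_set n Y V))
    \<longleftrightarrow> block_union a (vertex_set X Y) \<and> block_union b (vertex_set U V)"
proof -
  let ?sh = "shift_vertex m n" and ?S = "vertex_set X Y"
  let ?b = "(\<lambda>B. ?sh ` B) ` b" and ?S' = "?sh ` vertex_set U V"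
  have inj: "inj ?sh" by (rule injI, case_tac x; case_tac y; simp)
  have Ua: "\<Union>a = verts m n" and Ub: "\<Union>?b = ?sh ` verts s t"
    using pairingD(1)[OF a] pairingD(1)[OF b] by (simp_all add: image_Union flip: pairingD(1)[OF b])
  have disj: "verts m n \<inter> ?sh ` verts s t = {}" by (auto simp: verts_def)
  have S: "?S \<subseteq> verts m n" "?S' \<subseteq> ?sh ` verts s t"
    using vertex_set_subset[OF XY] vertex_set_subset[OF UV] by blast+
  have "vertex_set (append_set m X U) (append_set n Y V) = ?S \<union> ?S'"
    by (auto simp: vertex_set_def append_set_def image_Un image_image)
  moreover have "block_union (a \<union> ?b) (?S \<union> ?S') \<longleftrightarrow> block_union a ?S \<and> block_union ?b ?S'"
    by (rule block_union_Un) (simp_all only: Ua Ub disj S)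
  ultimately show ?thesis by (simp only: diagram_tensor_def block_union_image[OF inj])
qed

lemma TL_rep_tensor:
  fixes f g :: "'k::field combination"
  assumes f: "Poly_Mapping.keys f \<subseteq> TL m n" and g: "Poly_Mapping.keys g \<subseteq> TL s t"
  shows "TL_rep (m + s) (n + t) (TL_tensor m n f g) = kronecker (TL_rep m n f) (TL_rep s t g)"
proof (rule eq_mat_subsetsI)
  note dims = carrier_matD[OF TL_rep_carrier]
  show "kronecker (TL_rep m n f) (TL_rep s t g) \<in> carrier_mat (2 ^ (m + s)) (2 ^ (n + t))"
    by (simp add: kronecker_def dims power_add)
  fix P Q assume PQ: "P \<subseteq> {1..m + s}" "Q \<subseteq> {1..n + t}"
  obtain X U where XU: "X \<subseteq> {1..m}" "U \<subseteq> {1..s}" "P = append_set m X U" using append_set_cases[OF PQ(1)] .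
  obtain Y V where YV: "Y \<subseteq> {1..n}" "V \<subseteq> {1..t}" "Q = append_set n Y V" using append_set_cases[OF PQ(2)] .
  let ?l = "Poly_Mapping.lookup" and ?k = "Poly_Mapping.keys"
  let ?A = "\<lambda>a X Y. of_bool (block_union a (vertex_set X Y)) :: 'k"
  have index: "subset_index (m + s) P < 2 ^ m * 2 ^ s" "subset_index (n + t) Q < 2 ^ n * 2 ^ t"
    using subset_index_less[OF PQ(1)] subset_index_less[OF PQ(2)] by (simp_all add: power_add)
  have "kronecker (TL_rep m n f) (TL_rep s t g) $$ (subset_index (m + s) P, subset_index (n + t) Q)
    = TL_rep m n f $$ (subset_index m X, subset_index n Y) * TL_rep s t g $$ (subset_index s U, subset_index t V)"
    using index subset_index_less[OF XU(2)] subset_index_less[OF YV(2)]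
    by (simp add: kronecker_def dims XU(3) YV(3) subset_index_append[OF XU(1,2)] subset_index_append[OF YV(1,2)])
  also have "\<dots> = (\<Sum>a\<in>?k f. \<Sum>b\<in>?k g. ?l f a * ?l g b * (?A a X Y * ?A b U V))"
    unfolding TL_rep_entry[OF XU(1) YV(1)] TL_rep_entry[OF XU(2) YV(2)] by (rule linear_extension_mult)
  also have "\<dots> = (\<Sum>a\<in>?k f. \<Sum>b\<in>?k g. ?l f a * ?l g b * ?A (diagram_tensor m n a b) P Q)"
  proof (intro sum.cong refl)
    fix a b assume "a \<in> ?k f" "b \<in> ?k g"
    hence "pairing m n a" "pairing s t b" using f g TL_D(1) by blast+
    from block_union_tensor[OF this XU(1) YV(1) XU(2) YV(2)]
    show "?l f a * ?l g b * (?A a X Y * ?A b U V) = ?l f a * ?l g b * ?A (diagram_tensor m n a b) P Q"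
      unfolding XU(3) YV(3) by simp
  qed
  also have "\<dots> = TL_rep (m + s) (n + t) (TL_tensor m n f g) $$ (subset_index (m + s) P, subset_index (n + t) Q)"
    unfolding TL_rep_entry[OF PQ] TL_tensor_def linear_extension_sum by simp
  finally show "TL_rep (m + s) (n + t) (TL_tensor m n f g) $$ (subset_index (m + s) P, subset_index (n + t) Q)
    = kronecker (TL_rep m n f) (TL_rep s t g) $$ (subset_index (m + s) P, subset_index (n + t) Q)" by (rule sym)
qed simp

lemma TL_rep_add: "TL_rep m n (f + g) = TL_rep m n f + TL_rep m n g"
proof (rule eq_mat_subsetsI)
  fix X Y assume XY: "X \<subseteq> {1..m}" "Y \<subseteq> {1..n}"
  thus "TL_rep m n (f + g) $$ (subset_index m X, subset_index n Y)
      = (TL_rep m n f + TL_rep m n g) $$ (subset_index m X, subset_index n Y)"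
    using subset_index_less[of X m] subset_index_less[of Y n]
    by (simp add: carrier_matD[OF TL_rep_carrier] TL_rep_entry linear_extension_add)
qed simp_all

lemma TL_rep_scale: "TL_rep m n (Poly_Mapping.map ((*) c) f) = c \<cdot>\<^sub>m TL_rep m n f"
proof (rule eq_mat_subsetsI)
  fix X Y assume XY: "X \<subseteq> {1..m}" "Y \<subseteq> {1..n}"
  thus "TL_rep m n (Poly_Mapping.map ((*) c) f) $$ (subset_index m X, subset_index n Y)
      = (c \<cdot>\<^sub>m TL_rep m n f) $$ (subset_index m X, subset_index n Y)"
    using subset_index_less[of X m] subset_index_less[of Y n]
    by (simp add: carrier_matD[OF TL_rep_carrier] TL_rep_entry linear_extension_scale)
qed simp_all

theorem theorem7p4:
  shows "(\<forall>m n. \<forall>a\<in>TL m n.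
            TL_rep m n (Poly_Mapping.single a (1 :: 'k::field_char_0)) = diagram_matrix m n a)
       \<and> is_functor (TL_cat (2 :: 'k)) mat_cat (\<lambda>n. 2 ^ n) TL_rep
       \<and> faithful_rep (TL_cat (2 :: 'k)) (\<lambda>n. 2 ^ n :: nat) TL_rep
       \<and> involutive_rep (TL_cat (2 :: 'k)) mat_cat TL_rep
       \<and> linear_rep (TL_cat (2 :: 'k)) mat_cat TL_rep
       \<and> tensor_rep (TL_cat (2 :: 'k)) mat_cat (\<lambda>n. 2 ^ n) TL_rep"
proof (intro conjI)
  show "\<forall>m n. \<forall>a\<in>TL m n. TL_rep m n (Poly_Mapping.single a (1 :: 'k)) = diagram_matrix m n a"
    by (simp add: TL_rep_single)
  show "is_functor (TL_cat (2 :: 'k)) mat_cat (\<lambda>n. 2 ^ n) TL_rep"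
    using is_category_TL[where 'k = 'k] is_category_mat[where 'k = 'k]
    by (simp add: is_functor_def) (simp add: TL_cat_def mat_cat_def TL_rep_id TL_rep_comp)
  show "faithful_rep (TL_cat (2 :: 'k)) (\<lambda>n. 2 ^ n :: nat) TL_rep"
    unfolding faithful_rep_def
  proof
    show "inj (\<lambda>n. 2 ^ n :: nat)" by (rule injI) simp
    show "inj_on (\<lambda>(m, n, f). (2 ^ m :: nat, 2 ^ n :: nat, TL_rep m n f)) {(m, n, f). f \<in> Hom (TL_cat (2 :: 'k)) m n}"
      by (rule inj_onI) (clarsimp simp: TL_cat_def, rule TL_rep_inj)
  qed
  show "involutive_rep (TL_cat (2 :: 'k)) mat_cat TL_rep"
    by (simp add: involutive_rep_def TL_cat_def mat_cat_def TL_rep_star)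
  show "linear_rep (TL_cat (2 :: 'k)) mat_cat TL_rep"
    by (simp add: linear_rep_def TL_cat_def mat_cat_def TL_rep_add TL_rep_scale)
  show "tensor_rep (TL_cat (2 :: 'k)) mat_cat (\<lambda>n. 2 ^ n) TL_rep"
    by (simp add: tensor_rep_def TL_cat_def mat_cat_def TL_rep_tensor power_add)
qed

end
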